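(* Let $Q>1$ and $\epsilon>0$. Let $(X,d,\mu)$ be a $Q$-doubling metric measure space which satisfies a chain condition. Let $u:X\to\mathbb{R}$ be integrable on balls and let $g\in L^Q(X)$, $g\ge 0$, be such that there exist constants $C>0$ and $\lambda\ge 1$ with $$\frac{1}{\mu(B)}\int_B |u-u_B|\,d\mu\le C\,\operatorname{diam}(B)\left(\frac{1}{\mu(\lambda B)}\int_{\lambda B} g^Q\,d\mu\right)^{1/Q}$$ for every open ball $B\subset X$, where $u_B=\frac{1}{\mu(B)}\int_B u\,d\mu$. Then there is a set $E_\epsilon\subset X$ with $H^h(E_\epsilon)=0$, where $h(t)=\log^{1-Q-\epsilon}(1/t)$, such that for every $x\in X\setminus E_\epsilon$ the limit $$\lim_{r\to 0}\frac{1}{\mu(B(x,r))}\int_{B(x,r)}u(y)\,d\mu(y)$$ exists, and (replacing $u$ by this limit, which gives a representative of $u$) one has $u(x)=\lim_{r\to 0}\frac{1}{\mu(B(x,r))}\int_{B(x,r)}u\,d\mu$ for all $x\in X\setminus E_\epsilon$.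
   Context: $\mu$ is a Borel regular outer measure on the metric space $(X,d)$. $\mu$ is doubling if every ball has positive finite measure and $\mu(B(x,2r))\le C_\mu\mu(B(x,r))$ for all $x\in X$, $r>0$. $(X,d,\mu)$ is $Q$-doubling if $\mu$ is doubling and there is $C\ge1$ with $(s/r)^Q\le C\,\mu(B(x,s))/\mu(B(a,r))$ whenever $a\in X$, $x\in B(a,r)$, $0<s\le r$. For a ball $B=B(x,r)=\{y:d(x,y)<r\}$, $\lambda B=B(x,\lambda r)$. Chain condition: for every $\lambda\ge1$ there are constants $M\ge1$, $0<m\le1$ such that for each $x\in X$ and all $0<r<\operatorname{diam}(X)/8$ there is a sequence of balls $B_0,B_1,\dots$ with (1) $B_0\subset X\setminus B(x,r)$; (2) $M^{-1}\operatorname{diam}(B_i)\le \operatorname{dist}(x,B_i)\le M\operatorname{diam}(B_i)$; (3) $\operatorname{dist}(x,B_i)\le Mr2^{-mi}$; (4) there is a ball $D_i\subset B_i\cap B_{i+1}$ with $B_i\cup B_{i+1}\subset MD_i$, for all $i\ge0$; (5) no point of $X$ belongs to more than $M$ of the balls $\lambda B_i$. Generalized Hausdorff measure: $H^h(E)=\limsup_{\delta\to0}H^h_\delta(E)$, $H^h_\delta(E)=\inf\{\sum_i h(\operatorname{diam}(B_i)): E\subset\bigcup_i B_i,\ \operatorname{diam}(B_i)\le\delta\}$. *)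

theory Defs
  imports "HOL-Analysis.Analysis"
begin

definition borel_regular_measure :: "'a::metric_space measure \<Rightarrow> bool" where
  "borel_regular_measure M \<longleftrightarrow>
     space M = UNIV \<and> sets borel \<subseteq> sets M \<and>
     (\<forall>A\<in>sets M. \<exists>B\<in>sets borel. A \<subseteq> B \<and> emeasure M B = emeasure M A)"

definition doubling :: "'a::metric_space measure \<Rightarrow> bool" where
  "doubling M \<longleftrightarrow>
     (\<forall>x r. r > 0 \<longrightarrow> 0 < emeasure M (ball x r) \<and> emeasure M (ball x r) < \<infinity>) \<and>
     (\<exists>C. \<forall>x r. r > 0 \<longrightarrow> measure M (ball x (2 * r)) \<le> C * measure M (ball x r))"

definition Q_doubling :: "'a::metric_space measure \<Rightarrow> real \<Rightarrow> bool" where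
  "Q_doubling M Q \<longleftrightarrow> doubling M \<and>
     (\<exists>C\<ge>1. \<forall>a x r s. x \<in> ball a r \<and> 0 < s \<and> s \<le> r \<longrightarrow>
        (s / r) powr Q \<le> C * measure M (ball x s) / measure M (ball a r))"

text \<open>Chain condition. Ball B_i = ball (c i) (\<rho> i); diam(X) is infinite
  when X is unbounded, in which case the restriction on r is vacuous.\<close>
definition chain_condition :: "'a::metric_space itself \<Rightarrow> bool" where
  "chain_condition _ \<longleftrightarrow>
    (\<forall>lam::real. lam \<ge> 1 \<longrightarrow>
      (\<exists>Mc::real. Mc \<ge> 1 \<and> (\<exists>m::real. 0 < m \<and> m \<le> 1 \<and>
        (\<forall>(x::'a) r. 0 < r \<and> (bounded (UNIV::'a set) \<longrightarrow> r < diameter (UNIV::'a set) / 8) \<longrightarrow>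
          (\<exists>(c::nat \<Rightarrow> 'a) (\<rho>::nat \<Rightarrow> real).
             (\<forall>i. \<rho> i > 0) \<and>
             ball (c 0) (\<rho> 0) \<subseteq> UNIV - ball x r \<and>
             (\<forall>i. diameter (ball (c i) (\<rho> i)) / Mc \<le> infdist x (ball (c i) (\<rho> i)) \<and>
                  infdist x (ball (c i) (\<rho> i)) \<le> Mc * diameter (ball (c i) (\<rho> i))) \<and>
             (\<forall>i. infdist x (ball (c i) (\<rho> i)) \<le> Mc * r * 2 powr (- m * real i)) \<and>
             (\<forall>i. \<exists>d s. s > 0 \<and> ball d s \<subseteq> ball (c i) (\<rho> i) \<inter> ball (c (Suc i)) (\<rho> (Suc i)) \<and>
                  ball (c i) (\<rho> i) \<union> ball (c (Suc i)) (\<rho> (Suc i)) \<subseteq> ball d (Mc * s)) \<and>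
             (\<forall>y::'a. finite {i. y \<in> ball (c i) (lam * \<rho> i)} \<and>
                  real (card {i. y \<in> ball (c i) (lam * \<rho> i)}) \<le> Mc))))))"

text \<open>Generalized Hausdorff measure with gauge h, via countable covers by balls
  (radius 0 allowed, giving empty balls, so finite covers are included).\<close>
definition hausdorff_delta :: "(real \<Rightarrow> real) \<Rightarrow> real \<Rightarrow> 'a::metric_space set \<Rightarrow> ennreal" where
  "hausdorff_delta h \<delta> E =
     (INF cr \<in> {(c::nat \<Rightarrow> 'a, r::nat \<Rightarrow> real).
                 (\<forall>i. r i \<ge> 0 \<and> diameter (ball (c i) (r i)) \<le> \<delta>) \<and> E \<subseteq> (\<Union>i. ball (c i) (r i))}.
        (\<Sum>i. ennreal (h (diameter (ball (fst cr i) (snd cr i))))))"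

definition gen_hausdorff :: "(real \<Rightarrow> real) \<Rightarrow> 'a::metric_space set \<Rightarrow> ennreal" where
  "gen_hausdorff h E = Limsup (at_right 0) (\<lambda>\<delta>. hausdorff_delta h \<delta> E)"

text \<open>h(t) = log^(1-Q-eps)(1/t), with h(0) = 0 (its limit).\<close>
definition log_gauge :: "real \<Rightarrow> real \<Rightarrow> real \<Rightarrow> real" where
  "log_gauge Q \<epsilon> t = (if t \<le> 0 then 0 else (ln (1 / t)) powr (1 - Q - \<epsilon>))"

definition avg :: "'a measure \<Rightarrow> ('a \<Rightarrow> real) \<Rightarrow> 'a set \<Rightarrow> real" where
  "avg M u B = (\<integral>y\<in>B. u y \<partial>M) / measure M B"

end

theory Submission
  imports Defs
begin

text \<open>
  Put \<open>f = g\<^sup>Q\<close> and let \<open>E\<close> be the set of those \<open>x\<close> for which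
  \<open>\<integral>\<^bsub>B(x, R\<^sub>k)\<^esub> f > 2\<^bsup>-k(Q - 1 + \<epsilon>/2)\<^esup>\<close> for infinitely many \<open>k\<close>, where
  \<open>R\<^sub>k = exp (-2\<^sup>k)\<close>. The gauge varies so slowly that only these scales matter: at scale \<open>k\<close>
  the centres of disjoint bad balls number at most a multiple of \<open>2\<^bsup>k(Q - 1 + \<epsilon>/2)\<^esup>\<close>, while
  \<open>h(4R\<^sub>k)\<close> is comparable to \<open>2\<^bsup>-k(Q - 1 + \<epsilon>)\<^esup>\<close>, so \<open>H\<^sup>h(E) = 0\<close> by summing a geometric series,
  and no Vitali covering is needed.

  For \<open>x\<close> outside \<open>E\<close>, the chain towards \<open>x\<close>, the Poincare inequality and the lower mass bound
  \<open>\<mu>(B(c, t)) \<ge> \<kappa> t\<^sup>Q\<close> bound consecutive differences of averages by \<open>a\<^sub>i\<^bsup>1/Q\<^esup>\<close> with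
  \<open>a\<^sub>i = \<integral>\<^bsub>\<lambda>B\<^sub>i\<^esub> f\<close>. Bounded overlap controls the sum of the \<open>a\<^sub>i\<close> over a dyadic block of
  indices by \<open>2\<^bsup>-k(Q - 1 + \<epsilon>/2)\<^esup>\<close>, and Hoelder within the block makes the total summable. Arbitrary
  balls around \<open>x\<close> are compared with the first chain ball that they contain.

  The limit equals \<open>u\<close> almost everywhere because the mean oscillation tends to \<open>0\<close> outside \<open>E\<close>,
  whereas a measurable set has density \<open>0\<close> at almost none of its points.
\<close>

section \<open>Separated sets and averages\<close>

text \<open>The sum of the indicators at a point counts the sets containing it: at most
  \<open>N\<close> inside \<open>U\<close>, zero outside. This pointwise bound is integrated against
  \<open>f\<close>.\<close>

lemma sum_set_integral_le_overlap:
  fixes f :: "'b \<Rightarrow> real"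
  assumes "finite I" and A: "\<And>i. i \<in> I \<Longrightarrow> A i \<in> sets M" "\<And>i. i \<in> I \<Longrightarrow> A i \<subseteq> U"
    and f: "set_integrable M U f" and f0: "\<And>y. 0 \<le> f y"
    and N: "\<And>y. real (card {i \<in> I. y \<in> A i}) \<le> N"
  shows "(\<Sum>i\<in>I. LINT y:A i|M. f y) \<le> N * (LINT y:U|M. f y)"
proof -
  have int: "set_integrable M (A i) f" if "i \<in> I" for i
    using set_integrable_subset[OF f] A that by blast
  have "(\<Sum>i\<in>I. LINT y:A i|M. f y) = (LINT y|M. (\<Sum>i\<in>I. indicator (A i) y *\<^sub>R f y))"
    unfolding set_lebesgue_integral_def
    using int by (subst Bochner_Integration.integral_sum) (auto simp: set_integrable_def)
  also have "\<dots> \<le> (LINT y|M. N * (indicator U y *\<^sub>R f y))"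
  proof (rule integral_mono)
    show "integrable M (\<lambda>y. \<Sum>i\<in>I. indicator (A i) y *\<^sub>R f y)"
      using int by (auto simp: set_integrable_def)
    show "integrable M (\<lambda>y. N * (indicator U y *\<^sub>R f y))"
      using f by (auto simp: set_integrable_def)
    fix y
    have "(\<Sum>i\<in>I. indicator (A i) y *\<^sub>R f y) = real (card {i \<in> I. y \<in> A i}) * f y"
      using \<open>finite I\<close>
      by (simp add: sum_distrib_right[symmetric] indicator_def sum.If_cases Int_def)
    also have "\<dots> \<le> N * (indicator U y *\<^sub>R f y)"
    proof (cases "y \<in> U")
      case True
      then show ?thesis using N[of y] f0[of y] by (simp add: mult_right_mono)
    next
      case False
      then have "{i \<in> I. y \<in> A i} = {}" using A by blast
      then have "card {i \<in> I. y \<in> A i} = 0" by (metis card.empty)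
      then show ?thesis using False by simp
    qed
    finally show "(\<Sum>i\<in>I. indicator (A i) y *\<^sub>R f y) \<le> N * (indicator U y *\<^sub>R f y)" .
  qed
  finally show ?thesis by (simp add: set_lebesgue_integral_def)
qed

lemma sum_set_integral_le_disjoint:
  fixes f :: "'b \<Rightarrow> real"
  assumes "finite I" and A: "\<And>i. i \<in> I \<Longrightarrow> A i \<in> sets M" "\<And>i. i \<in> I \<Longrightarrow> A i \<subseteq> U"
    and f: "set_integrable M U f" and f0: "\<And>y. 0 \<le> f y"
    and disj: "disjoint_family_on A I"
  shows "(\<Sum>i\<in>I. LINT y:A i|M. f y) \<le> (LINT y:U|M. f y)"
proof -
  have "real (card {i \<in> I. y \<in> A i}) \<le> 1" for y
  proof -
    have "i = j" if "i \<in> {i \<in> I. y \<in> A i}" "j \<in> {i \<in> I. y \<in> A i}" for i j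
      using disj that by (auto simp: disjoint_family_on_def)
    then have "card {i \<in> I. y \<in> A i} \<le> 1"
      using \<open>finite I\<close> card_le_Suc0_iff_eq[of "{i \<in> I. y \<in> A i}"] by simp
    then show ?thesis by simp
  qed
  from sum_set_integral_le_overlap[OF assms(1-5) this] show ?thesis by simp
qed

lemma diameter_metric_ball_le:
  fixes x :: "'a::metric_space"
  assumes "r \<ge> 0"
  shows "diameter (ball x r) \<le> 2 * r"
proof (cases "r = 0")
  case False
  have "dist y z \<le> 2 * r" if "y \<in> ball x r" "z \<in> ball x r" for y z
    using that dist_triangle2[of y z x] by (simp add: dist_commute)
  then show ?thesis
    using assms False by (auto simp: diameter_def intro!: cSUP_least)
qed simp

definition separated :: "real \<Rightarrow> 'a::metric_space set \<Rightarrow> bool" where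
  "separated s P \<longleftrightarrow> (\<forall>p\<in>P. \<forall>q\<in>P. p \<noteq> q \<longrightarrow> s \<le> dist p q)"

lemma disjoint_balls_separated:
  assumes "separated s P"
  shows "disjoint_family_on (\<lambda>p. ball p (s / 2)) P"
proof -
  have False if "p \<in> P" "q \<in> P" "p \<noteq> q" "dist p y < s / 2" "dist q y < s / 2" for p q y
  proof -
    have "s \<le> dist p q" using assms that by (auto simp: separated_def)
    moreover have "dist p q < s" using that dist_triangle2[of p q y] by linarith
    ultimately show False by simp
  qed
  then show ?thesis by (auto simp: disjoint_family_on_def)
qed

text \<open>The cardinality bound allows the choice of a separated subset of greatest size; a point
  of \<open>A\<close> missed by its \<open>s\<close>-balls could be adjoined to it.\<close>

lemma ex_maximal_separated:
  fixes A :: "'a::metric_space set"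
  assumes "s > 0"
    and bound: "\<And>P. finite P \<Longrightarrow> P \<subseteq> A \<Longrightarrow> separated s P \<Longrightarrow> real (card P) \<le> N"
  obtains P where "finite P" "P \<subseteq> A" "separated s P" "A \<subseteq> (\<Union>p\<in>P. ball p s)"
proof -
  let ?Q = "\<lambda>P. finite P \<and> P \<subseteq> A \<and> separated s P"
  have "?Q {}" by (simp add: separated_def)
  moreover have "\<forall>P. ?Q P \<longrightarrow> card P < Suc (nat \<lfloor>N\<rfloor>)"
    using bound le_nat_floor by (simp add: less_Suc_eq_le)
  ultimately obtain P where P: "?Q P" and max: "\<And>P'. ?Q P' \<Longrightarrow> card P' \<le> card P"
    using ex_has_greatest_nat[of ?Q "{}" card "Suc (nat \<lfloor>N\<rfloor>)"] by blast
  have "x \<in> (\<Union>p\<in>P. ball p s)" if "x \<in> A" for x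
  proof (rule ccontr)
    assume *: "x \<notin> (\<Union>p\<in>P. ball p s)"
    have "x \<notin> P" using * \<open>s > 0\<close> by force
    moreover have "separated s (insert x P)"
      using P * by (auto simp: separated_def dist_commute not_less)
    ultimately show False using P that max[of "insert x P"] by simp
  qed
  with P that show ?thesis by blast
qed

text \<open>Enlarging the domain of the integral of \<open>\<bar>u y - c\<bar>\<close> from
  \<open>D\<close> to \<open>B\<close> only increases it, and the change of normalisation costs the
  factor \<open>K\<close>. With \<open>c\<close> the average over \<open>B\<close>, the right side
  is \<open>K\<close> times the mean oscillation.\<close>

lemma avg_subset_diff_le:
  fixes u :: "'b \<Rightarrow> real"
  assumes D: "D \<in> sets M" "D \<subseteq> B" "measure M D > 0"
    and B: "B \<in> fmeasurable M" and u: "set_integrable M B u"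
    and K: "measure M B \<le> K * measure M D"
  shows "\<bar>avg M u D - c\<bar> \<le> K * avg M (\<lambda>y. \<bar>u y - c\<bar>) B"
proof -
  have uD: "set_integrable M D u"
    using set_integrable_subset[OF u] D by blast
  have D': "D \<in> fmeasurable M" using fmeasurableI2[OF B D(2,1)] .
  have const: "set_integrable M A (\<lambda>_. c)" if "A \<in> fmeasurable M" for A
    using that unfolding set_integrable_def
    by (auto simp: fmeasurable_def intro!: integrable_scaleR_left)
  have intB: "set_integrable M B (\<lambda>y. \<bar>u y - c\<bar>)"
    using set_integrable_abs[OF set_integral_diff(1)[OF u const[OF B]]] .
  have intD: "set_integrable M D (\<lambda>y. u y - c)"
    using set_integral_diff(1)[OF uD const[OF D']] .
  have mono: "(LINT y:D|M. \<bar>u y - c\<bar>) \<le> (LINT y:B|M. \<bar>u y - c\<bar>)"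
    unfolding set_lebesgue_integral_def
    using intB set_integrable_subset[OF intB D(1,2)] D(2)
    by (intro integral_mono) (auto simp: set_integrable_def indicator_def)
  have Bpos: "measure M B > 0"
    using measure_mono_fmeasurable[OF D(2,1) B] D(3) by linarith
  have "avg M u D - c = (LINT y:D|M. u y - c) / measure M D"
  proof -
    have "(LINT y:D|M. u y - c) = (LINT y:D|M. u y) - (LINT y:D|M. c)"
      using set_integral_diff(2)[OF uD const[OF D']] .
    also have "(LINT y:D|M. c) = measure M D * c"
      using D' by (simp add: set_lebesgue_integral_def fmeasurable_def)
    finally show ?thesis using D(3) by (simp add: avg_def field_simps)
  qed
  then have "\<bar>avg M u D - c\<bar> = \<bar>LINT y:D|M. u y - c\<bar> / measure M D"
    using D(3) by simp
  also have "\<dots> \<le> (LINT y:D|M. \<bar>u y - c\<bar>) / measure M D"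
    using set_integral_norm_bound[OF intD] D(3) by (simp add: divide_right_mono)
  also have "\<dots> \<le> (LINT y:B|M. \<bar>u y - c\<bar>) / measure M D"
    using mono D(3) by (simp add: divide_right_mono)
  also have "\<dots> = (measure M B / measure M D) * avg M (\<lambda>y. \<bar>u y - c\<bar>) B"
    using Bpos by (simp add: avg_def)
  also have "\<dots> \<le> K * avg M (\<lambda>y. \<bar>u y - c\<bar>) B"
  proof (rule mult_right_mono)
    show "measure M B / measure M D \<le> K" using K D(3) by (simp add: field_simps)
    show "0 \<le> avg M (\<lambda>y. \<bar>u y - c\<bar>) B"
      unfolding avg_def set_lebesgue_integral_def by (intro divide_nonneg_nonneg integral_nonneg_AE) auto
  qed
  finally show ?thesis .
qed

section \<open>Doubling measures: comparison of balls, finite nets, density points\<close>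

locale doubling_measure =
  fixes M :: "'a::metric_space measure"
  assumes space_M: "space M = UNIV" and borel_sets: "sets borel \<subseteq> sets M"
    and doubling: "doubling M"
begin

lemma ball_sets [simp, measurable]: "ball x r \<in> sets M"
  using borel_sets by auto

lemma emeasure_ball_finite: "emeasure M (ball x r) < \<infinity>"
  using doubling by (cases "r > 0") (auto simp: doubling_def ball_empty)

lemma ball_fmeasurable [simp]: "ball x r \<in> fmeasurable M"
  using emeasure_ball_finite by (auto simp: fmeasurable_def)

lemma measure_ball_pos: "r > 0 \<Longrightarrow> 0 < measure M (ball x r)"
  using doubling emeasure_ball_finite[of x r]
  by (auto simp: doubling_def measure_def enn2real_positive_iff)

lemma measure_mono_ball: "A \<in> sets M \<Longrightarrow> A \<subseteq> ball x r \<Longrightarrow> measure M A \<le> measure M (ball x r)"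
  by (rule measure_mono_fmeasurable) auto

text \<open>\<open>ball x r\<close> lies in the ball about \<open>y\<close> of radius
  \<open>2 * K * s\<close>, and a fixed number of doublings of \<open>s\<close>, depending only on
  \<open>K\<close>, reaches that radius.\<close>

lemma ball_comparison:
  obtains C where "C \<ge> 1"
    "\<And>x y r s. s > 0 \<Longrightarrow> r \<le> K * s \<Longrightarrow> dist x y \<le> K * s \<Longrightarrow>
      measure M (ball x r) \<le> C * measure M (ball y s)"
proof -
  obtain C0 where C0: "\<And>x r. r > 0 \<Longrightarrow> measure M (ball x (2 * r)) \<le> C0 * measure M (ball x r)"
    using doubling by (auto simp: doubling_def)
  define C1 where "C1 = max 1 C0"
  have C1: "measure M (ball x (2 * r)) \<le> C1 * measure M (ball x r)" if "r > 0" for x r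
    using C0[OF that, of x] mult_right_mono[of C0 C1 "measure M (ball x r)"]
    by (simp add: C1_def)
  have iter: "measure M (ball y (2 ^ n * s)) \<le> C1 ^ n * measure M (ball y s)" if "s > 0" for y s n
  proof (induction n)
    case (Suc n)
    have "measure M (ball y (2 ^ Suc n * s)) \<le> C1 * measure M (ball y (2 ^ n * s))"
      using C1[of "2 ^ n * s" y] that by (simp add: mult.assoc)
    also have "\<dots> \<le> C1 * (C1 ^ n * measure M (ball y s))"
      using Suc by (intro mult_left_mono) (auto simp: C1_def)
    finally show ?case by (simp add: mult.assoc)
  qed simp
  obtain n where n: "2 * K < 2 ^ n" using real_arch_pow[of 2 "2 * K"] by auto
  show thesis
  proof
    show "1 \<le> C1 ^ n" by (simp add: C1_def one_le_power)
    fix x y :: 'a and r s :: real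
    assume s: "s > 0" "r \<le> K * s" "dist x y \<le> K * s"
    have "r + dist x y \<le> 2 ^ n * s"
      using s mult_strict_right_mono[OF n \<open>s > 0\<close>] by linarith
    then have "z \<in> ball y (2 ^ n * s)" if "z \<in> ball x r" for z
      using that dist_triangle[of y z x] by (simp add: dist_commute)
    then have "ball x r \<subseteq> ball y (2 ^ n * s)"
      by blast
    then show "measure M (ball x r) \<le> C1 ^ n * measure M (ball y s)"
      using measure_mono_ball[OF ball_sets] iter[OF s(1), of y n] by (meson order_trans)
  qed
qed

text \<open>Packing by measure: the half-radius balls about separated points are disjoint, lie in
  one ball of radius \<open>T\<close>, and each carries at least the fraction \<open>1 / C\<close>
  of its measure, so there are at most \<open>C\<close> of them.\<close>

lemma ex_finite_net:
  fixes A :: "'a set"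
  assumes "s > 0" and A: "A \<subseteq> ball x0 R"
  obtains P where "finite P" "P \<subseteq> A" "separated s P" "A \<subseteq> (\<Union>p\<in>P. ball p s)"
proof -
  define T where "T = R + s"
  obtain C where C: "C \<ge> 1" "\<And>x y r t. t > 0 \<Longrightarrow> r \<le> (2 * \<bar>T\<bar> / s) * t \<Longrightarrow> dist x y \<le> (2 * \<bar>T\<bar> / s) * t \<Longrightarrow>
      measure M (ball x r) \<le> C * measure M (ball y t)"
    using ball_comparison by metis
  show thesis
  proof (rule ex_maximal_separated[OF \<open>s > 0\<close>, of A C])
    fix P assume P: "finite P" "P \<subseteq> A" "separated s P"
    show "real (card P) \<le> C"
    proof (cases "P = {}")
      case True
      with C show ?thesis by simp
    next
      case False
      then have "R > 0" using P A by (metis all_not_in_conv ball_eq_empty linorder_not_less subset_empty)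
      then have "T > 0" using \<open>s > 0\<close> by (simp add: T_def)
      have "measure M (ball x0 T) \<le> C * measure M (ball p (s / 2))" if "p \<in> P" for p
        using C(2)[of "s / 2" T x0 p] that P A \<open>s > 0\<close> \<open>T > 0\<close> by (auto simp: T_def subset_iff)
      then have "(\<Sum>p\<in>P. measure M (ball x0 T)) \<le> (\<Sum>p\<in>P. C * measure M (ball p (s / 2)))"
        by (intro sum_mono) auto
      also have "\<dots> = C * measure M (\<Union>p\<in>P. ball p (s / 2))"
        using P disjoint_balls_separated[OF P(3)] emeasure_ball_finite
        by (subst measure_finite_Union) (auto simp: sum_distrib_left less_top)
      also have "\<dots> \<le> C * measure M (ball x0 T)"
      proof (intro mult_left_mono measure_mono_ball)
        show "(\<Union>p\<in>P. ball p (s / 2)) \<subseteq> ball x0 T"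
        proof clarify
          fix p y assume "p \<in> P" "y \<in> ball p (s / 2)"
          then have "dist x0 p < R" "dist p y < s / 2" using P A by auto
          then show "y \<in> ball x0 T" using dist_triangle[of x0 y p] \<open>s > 0\<close> by (simp add: T_def)
        qed
      qed (use P C in auto)
      finally show ?thesis using measure_ball_pos[OF \<open>T > 0\<close>, of x0] by simp
    qed
  qed (use that in blast)
qed

text \<open>At scale \<open>r\<close>, the points of \<^term>\<open>S\<close> in a fixed ball where the density is at most \<open>\<eta>\<close> are
  covered by a set of measure \<open>O(\<eta>)\<close>; a point of density \<open>0\<close> lies in the lower limit of
  these sets for every \<open>\<eta>\<close>.\<close>

lemma AE_not_zero_density:
  assumes S: "S \<in> sets M"
  shows "AE x in M. x \<in> S \<longrightarrow>
    \<not> ((\<lambda>r. measure M (S \<inter> ball x r) / measure M (ball x r)) \<longlongrightarrow> 0) (at_right 0)"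
proof -
  let ?dens = "\<lambda>x r. measure M (S \<inter> ball x r) / measure M (ball x r)"
  obtain x0 :: 'a where True by simp
  obtain C where C: "C \<ge> 1" "\<And>x y r s. s > 0 \<Longrightarrow> r \<le> 2 * s \<Longrightarrow> dist x y \<le> 2 * s \<Longrightarrow>
      measure M (ball x r) \<le> C * measure M (ball y s)"
    using ball_comparison by metis
  have "AE x in M. x \<in> ball x0 (real n) \<longrightarrow> x \<in> S \<longrightarrow> \<not> (?dens x \<longlongrightarrow> 0) (at_right 0)" for n
  proof -
    \<comment> \<open>All scales \<open>rr l\<close> are at most 1, so the extra unit of radius
      holds every small ball and \<open>C'\<close> serves for all \<open>l\<close>.\<close>
    define C' where "C' = C * measure M (ball x0 (real n + 1))"
    have "C' \<ge> 0" using C by (simp add: C'_def)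
    define rr where "rr l = 1 / real (Suc l)" for l
    have rr: "0 < rr l" "rr l \<le> 1" for l by (auto simp: rr_def divide_simps)
    define good where "good l \<eta> G \<longleftrightarrow> G \<in> sets M \<and> {x \<in> S \<inter> ball x0 (real n). ?dens x (rr l) \<le> \<eta>} \<subseteq> G
      \<and> emeasure M G \<le> ennreal (\<eta> * C')" for l \<eta> G
    have ex_good: "\<exists>G. good l \<eta> G" if "\<eta> > 0" for l \<eta>
    proof -
      define A where "A = {x \<in> S \<inter> ball x0 (real n). ?dens x (rr l) \<le> \<eta>}"
      have "A \<subseteq> ball x0 (real n)" by (auto simp: A_def)
      then obtain P where P: "finite P" "P \<subseteq> A" "separated (rr l) P" "A \<subseteq> (\<Union>p\<in>P. ball p (rr l))"
        using ex_finite_net[OF rr(1)[of l]] by metis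
      \<comment> \<open>A finite union of measurable traces, so its measurability does not rest on
        that of \<open>A\<close>.\<close>
      define G where "G = (\<Union>p\<in>P. S \<inter> ball p (rr l))"
      have G: "G \<in> fmeasurable M"
        unfolding G_def
      proof (rule fmeasurable.finite_UN[OF P(1)])
        fix p
        show "S \<inter> ball p (rr l) \<in> fmeasurable M"
          by (rule fmeasurableI2[OF ball_fmeasurable[of p "rr l"]]) (use S in auto)
      qed
      have "measure M G \<le> (\<Sum>p\<in>P. measure M (S \<inter> ball p (rr l)))"
        unfolding G_def using P S by (intro measure_UNION_le) auto
      \<comment> \<open>The centres belong to \<open>A\<close>, so the density bound applies at
        them; doubling then passes to the half balls, which are disjoint.\<close>
      also have "\<dots> \<le> (\<Sum>p\<in>P. \<eta> * (C * measure M (ball p (rr l / 2))))"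
      proof (rule sum_mono)
        fix p assume "p \<in> P"
        then have "?dens p (rr l) \<le> \<eta>" using P by (auto simp: A_def)
        then have "measure M (S \<inter> ball p (rr l)) \<le> \<eta> * measure M (ball p (rr l))"
          using measure_ball_pos[OF rr(1), of p l] by (simp add: field_simps)
        also have "\<dots> \<le> \<eta> * (C * measure M (ball p (rr l / 2)))"
          using C(2)[of "rr l / 2" "rr l" p p] rr[of l] \<open>\<eta> > 0\<close> by (intro mult_left_mono) auto
        finally show "measure M (S \<inter> ball p (rr l)) \<le> \<eta> * (C * measure M (ball p (rr l / 2)))" .
      qed
      also have "\<dots> = \<eta> * C * measure M (\<Union>p\<in>P. ball p (rr l / 2))"
        using P disjoint_balls_separated[OF P(3)] emeasure_ball_finite
        by (subst measure_finite_Union) (auto simp: sum_distrib_left less_top mult.assoc)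
      also have "\<dots> \<le> \<eta> * C * measure M (ball x0 (real n + 1))"
      proof (intro mult_left_mono measure_mono_ball)
        show "(\<Union>p\<in>P. ball p (rr l / 2)) \<subseteq> ball x0 (real n + 1)"
        proof clarify
          fix p y assume "p \<in> P" "y \<in> ball p (rr l / 2)"
          then have "dist x0 p < n" "dist p y < rr l / 2" using P by (auto simp: A_def)
          then show "y \<in> ball x0 (real n + 1)" using dist_triangle[of x0 y p] rr[of l] by simp
        qed
      qed (use P C \<open>\<eta> > 0\<close> in auto)
      finally have "measure M G \<le> \<eta> * C'" by (simp add: C'_def mult.assoc)
      then have "emeasure M G \<le> ennreal (\<eta> * C')"
        using G by (simp add: emeasure_eq_measure2 ennreal_leI)
      moreover have "A \<subseteq> G" using P by (auto simp: G_def A_def)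
      ultimately show ?thesis using G unfolding A_def good_def by (auto simp: fmeasurable_def)
    qed
    define G where "G l \<eta> = (SOME G. good l \<eta> G)" for l \<eta>
    have "good l \<eta> (G l \<eta>)" if "\<eta> > 0" for l \<eta>
      unfolding G_def using ex_good[OF that] by (rule someI_ex)
    then have G: "\<And>l \<eta>. \<eta> > 0 \<Longrightarrow> G l \<eta> \<in> sets M"
      "\<And>l \<eta>. \<eta> > 0 \<Longrightarrow> {x \<in> S \<inter> ball x0 (real n). ?dens x (rr l) \<le> \<eta>} \<subseteq> G l \<eta>"
      "\<And>l \<eta>. \<eta> > 0 \<Longrightarrow> emeasure M (G l \<eta>) \<le> ennreal (\<eta> * C')"
      by (simp_all only: good_def)
    \<comment> \<open>The lower limit in \<open>l\<close>: an increasing union of sets each inside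
      some \<open>G j \<eta>\<close>, so it inherits their measure bound.\<close>
    define H where "H \<eta> = (\<Union>j. \<Inter>l\<in>{j..}. G l \<eta>)" for \<eta>
    have Hs: "H \<eta> \<in> sets M" if "\<eta> > 0" for \<eta>
      unfolding H_def using G(1)[OF that] by (intro sets.countable_UN sets.countable_INT) auto
    have Hm: "emeasure M (H \<eta>) \<le> ennreal (\<eta> * C')" if "\<eta> > 0" for \<eta>
    proof -
      have "emeasure M (H \<eta>) = (SUP j. emeasure M (\<Inter>l\<in>{j..}. G l \<eta>))"
        unfolding H_def using G(1)[OF that]
        by (intro SUP_emeasure_incseq[symmetric]) (auto simp: incseq_def intro!: sets.countable_INT)
      also have "\<dots> \<le> ennreal (\<eta> * C')"
      proof (rule SUP_least)
        fix j
        have "emeasure M (\<Inter>l\<in>{j..}. G l \<eta>) \<le> emeasure M (G j \<eta>)"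
          using G(1)[OF that] by (intro emeasure_mono) auto
        then show "emeasure M (\<Inter>l\<in>{j..}. G l \<eta>) \<le> ennreal (\<eta> * C')"
          using G(3)[OF that, of j] by (rule order_trans)
      qed
      finally show ?thesis .
    qed
    \<comment> \<open>The sequence \<open>rr\<close> now provides the density thresholds as well as
      the scales; letting the threshold tend to 0 makes \<open>Z\<close> null.\<close>
    define Z where "Z = (\<Inter>i. H (rr i))"
    have Zs: "Z \<in> sets M" unfolding Z_def using Hs rr by auto
    have "emeasure M Z \<le> ennreal (rr i * C')" for i
    proof -
      have "emeasure M Z \<le> emeasure M (H (rr i))"
        using Hs rr by (intro emeasure_mono) (auto simp: Z_def)
      then show ?thesis using Hm[OF rr(1)] by (rule order_trans)
    qed
    moreover have "(\<lambda>i. ennreal (rr i * C')) \<longlonglongrightarrow> ennreal (0 * C')"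
      unfolding rr_def using LIMSEQ_inverse_real_of_nat
      by (intro tendsto_intros) (simp add: inverse_eq_divide)
    ultimately have "emeasure M Z \<le> ennreal (0 * C')"
      by (intro LIMSEQ_le_const) auto
    then have "emeasure M Z = 0" by simp
    then have "Z \<in> null_sets M" using Zs by auto
    then show ?thesis
    proof (rule AE_I')
      show "{x \<in> space M. \<not> (x \<in> ball x0 (real n) \<longrightarrow> x \<in> S \<longrightarrow> \<not> (?dens x \<longlongrightarrow> 0) (at_right 0))} \<subseteq> Z"
      proof
        fix x assume "x \<in> {x \<in> space M. \<not> (x \<in> ball x0 (real n) \<longrightarrow> x \<in> S \<longrightarrow> \<not> (?dens x \<longlongrightarrow> 0) (at_right 0))}"
        then have x: "x \<in> ball x0 (real n)" "x \<in> S" and lim: "(?dens x \<longlongrightarrow> 0) (at_right 0)"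
          by blast+
        have "filterlim rr (at_right 0) sequentially"
          unfolding rr_def using LIMSEQ_inverse_real_of_nat
          by (intro tendsto_imp_filterlim_at_right) (auto simp: inverse_eq_divide)
        then have lim': "(\<lambda>l. ?dens x (rr l)) \<longlonglongrightarrow> 0"
          by (rule filterlim_compose[OF lim])
        have "x \<in> H (rr i)" for i
        proof -
          have "eventually (\<lambda>l. ?dens x (rr l) < rr i) sequentially"
            using order_tendstoD(2)[OF lim' rr(1)] .
          then obtain j where "\<And>l. l \<ge> j \<Longrightarrow> ?dens x (rr l) < rr i"
            by (auto simp: eventually_sequentially)
          then have "x \<in> G l (rr i)" if "l \<ge> j" for l
            using G(2)[OF rr(1), of l i] x that by (fastforce intro: less_imp_le)
          then show ?thesis by (auto simp: H_def)
        qed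
        then show "x \<in> Z" by (auto simp: Z_def)
      qed
    qed
  qed
  then have "AE x in M. \<forall>n. x \<in> ball x0 (real n) \<longrightarrow> x \<in> S \<longrightarrow> \<not> (?dens x \<longlongrightarrow> 0) (at_right 0)"
    by (subst AE_all_countable) (rule allI)
  then show ?thesis
  proof (rule AE_mp, intro AE_I2 impI)
    fix x assume *: "\<forall>n. x \<in> ball x0 (real n) \<longrightarrow> x \<in> S \<longrightarrow> \<not> (?dens x \<longlongrightarrow> 0) (at_right 0)" "x \<in> S"
    obtain n where "dist x0 x < real n" using reals_Archimedean2 by blast
    with * show "\<not> (?dens x \<longlongrightarrow> 0) (at_right 0)" by auto
  qed
qed

end

section \<open>Dyadic blocks and the exceptional set\<close>

text \<open>Hoelder on a block of \<open>A * 2 ^ k\<close> terms multiplies the \<open>1 / Q\<close>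
  power of its sum by the \<open>1 - 1 / Q\<close> power of its length. The exponent
  \<open>Q - 1\<close> exactly absorbs this length, and \<open>\<gamma>\<close> leaves the geometric
  ratio \<open>q\<close>.\<close>

lemma summable_powr_dyadic_blocks:
  fixes a :: "nat \<Rightarrow> real"
  assumes a: "\<And>i. 0 \<le> a i" and "Q > 1" "\<gamma> > 0" "A > 0" "B > 0"
    and block: "\<And>k. k \<ge> k0 \<Longrightarrow> (\<Sum>i\<in>{A * 2 ^ k..<A * 2 ^ Suc k}. a i) \<le> B * 2 powr (- (real k * (Q - 1 + \<gamma>)))"
  shows "summable (\<lambda>i. a i powr (1 / Q))"
proof -
  define q where "q = 2 powr (- \<gamma> / Q)"
  have q: "0 < q" "q < 1" using assms by (auto simp: q_def powr_less_one)
  \<comment> \<open>The factor 2 is the loss in the pointwise substitute for Hoelder below; the rest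
    is \<open>N * t powr (1 / Q)\<close> without its dependence on \<open>k\<close>.\<close>
  define c where "c = 2 * real A * (B / real A) powr (1 / Q)"
  have "c \<ge> 0" by (simp add: c_def)
  have blk: "(\<Sum>i\<in>{A * 2 ^ k..<A * 2 ^ Suc k}. a i powr (1 / Q)) \<le> c * q ^ k" if "k \<ge> k0" for k
  proof -
    define N where "N = real A * 2 ^ k"
    define V where "V = B * 2 powr (- (real k * (Q - 1 + \<gamma>)))"
    define t where "t = V / N"
    have "N > 0" "V > 0" "t > 0" using assms by (auto simp: N_def V_def t_def)
    \<comment> \<open>replaces Hoelder's inequality: \<^term>\<open>t\<close> bounds the mean of \<^term>\<open>a\<close> over the block\<close>
    have pt: "a i powr (1 / Q) \<le> t powr (1 / Q) * (1 + a i / t)" for i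
    proof -
      have "a i powr (1 / Q) = t powr (1 / Q) * (a i / t) powr (1 / Q)"
        using \<open>t > 0\<close> a[of i] by (simp add: powr_mult[symmetric])
      moreover have "(a i / t) powr (1 / Q) \<le> 1 + a i / t"
      proof (cases "a i / t \<le> 1")
        case True
        then have "(a i / t) powr (1 / Q) \<le> 1"
          using a[of i] \<open>t > 0\<close> \<open>Q > 1\<close> by (intro powr_le1) auto
        then show ?thesis using a[of i] \<open>t > 0\<close> by (smt (verit) divide_nonneg_pos)
      next
        case False
        then have "(a i / t) powr (1 / Q) \<le> (a i / t) powr 1"
          using \<open>Q > 1\<close> by (intro powr_mono) auto
        then show ?thesis using False by simp
      qed
      ultimately show ?thesis by (simp add: mult_left_mono)
    qed
    have "(\<Sum>i\<in>{A * 2 ^ k..<A * 2 ^ Suc k}. a i powr (1 / Q))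
        \<le> (\<Sum>i\<in>{A * 2 ^ k..<A * 2 ^ Suc k}. t powr (1 / Q) * (1 + a i / t))"
      by (intro sum_mono pt)
    also have "\<dots> = t powr (1 / Q) * (N + (\<Sum>i\<in>{A * 2 ^ k..<A * 2 ^ Suc k}. a i) / t)"
      by (simp add: sum_distrib_left[symmetric] sum.distrib sum_divide_distrib[symmetric] N_def)
    also have "\<dots> \<le> t powr (1 / Q) * (N + V / t)"
      using block[OF that] \<open>t > 0\<close> by (intro mult_left_mono add_left_mono divide_right_mono) (auto simp: V_def)
    also have "\<dots> = 2 * N * t powr (1 / Q)"
      using \<open>t > 0\<close> \<open>N > 0\<close> \<open>V > 0\<close> by (simp add: t_def)
    also have "\<dots> = c * q ^ k"
    proof -
      have "t = (B / real A) * 2 powr (- (real k * (Q + \<gamma>)))"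
      proof -
        have "- (real k * (Q - 1 + \<gamma>)) = - (real k * (Q + \<gamma>)) + real k" by (simp add: algebra_simps)
        then have "2 powr (- (real k * (Q - 1 + \<gamma>))) = 2 powr (- (real k * (Q + \<gamma>))) * 2 ^ k"
          by (simp only: powr_add) (simp add: powr_realpow)
        then show ?thesis using \<open>A > 0\<close> by (simp add: t_def V_def N_def)
      qed
      then have "t powr (1 / Q) = (B / real A) powr (1 / Q) * 2 powr (- (real k * (Q + \<gamma>)) / Q)"
        using \<open>A > 0\<close> \<open>B > 0\<close> powr_mult[of "B / real A" "2 powr (- (real k * (Q + \<gamma>)))" "1 / Q"]
        by (simp add: powr_powr)
      moreover have "2 ^ k * 2 powr (- (real k * (Q + \<gamma>)) / Q) = q ^ k"
      proof -
        have "2 ^ k * 2 powr (- (real k * (Q + \<gamma>)) / Q) = 2 powr (real k + - (real k * (Q + \<gamma>)) / Q)"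
          by (simp only: powr_add powr_realpow zero_less_numeral)
        also have "real k + - (real k * (Q + \<gamma>)) / Q = (- \<gamma> / Q) * real k"
          using \<open>Q > 1\<close> by (simp add: field_simps)
        finally show ?thesis using powr_powr[of 2 "- \<gamma> / Q" "real k"] q by (simp add: q_def powr_realpow)
      qed
      ultimately show ?thesis by (simp add: c_def N_def mult.assoc mult.left_commute)
    qed
    finally show ?thesis .
  qed
  \<comment> \<open>The finitely many terms before the first controlled block.\<close>
  define S0 where "S0 = (\<Sum>i<A * 2 ^ k0. a i powr (1 / Q))"
  have part: "(\<Sum>i<A * 2 ^ (k0 + j). a i powr (1 / Q)) \<le> S0 + (\<Sum>l<j. c * q ^ l)" for j
  proof (induction j)
    case (Suc j)
    have "(\<Sum>i<A * 2 ^ (k0 + Suc j). a i powr (1 / Q)) =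
        (\<Sum>i<A * 2 ^ (k0 + j). a i powr (1 / Q)) + (\<Sum>i\<in>{A * 2 ^ (k0 + j)..<A * 2 ^ Suc (k0 + j)}. a i powr (1 / Q))"
      unfolding lessThan_atLeast0 by (subst sum.atLeastLessThan_concat) auto
    also have "\<dots> \<le> S0 + (\<Sum>l<j. c * q ^ l) + c * q ^ (k0 + j)"
      by (intro add_mono Suc blk) auto
    also have "\<dots> \<le> S0 + (\<Sum>l<j. c * q ^ l) + c * q ^ j"
      using q \<open>c \<ge> 0\<close> by (intro add_left_mono mult_left_mono power_decreasing) auto
    finally show ?case by simp
  qed (simp add: S0_def)
  show ?thesis
  proof (rule summableI_nonneg_bounded)
    fix n
    have "n \<le> A * 2 ^ (k0 + n)"
    proof -
      have "n \<le> 2 ^ (k0 + n)" using less_exp[of "k0 + n"] by linarith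
      also have "\<dots> \<le> A * 2 ^ (k0 + n)" using \<open>A > 0\<close> by simp
      finally show ?thesis .
    qed
    then have "(\<Sum>i<n. a i powr (1 / Q)) \<le> (\<Sum>i<A * 2 ^ (k0 + n). a i powr (1 / Q))"
      by (intro sum_mono2) auto
    also have "\<dots> \<le> S0 + (\<Sum>l<n. c * q ^ l)" by (rule part)
    also have "\<dots> \<le> S0 + (\<Sum>l. c * q ^ l)"
      using q \<open>c \<ge> 0\<close> by (intro add_left_mono sum_le_suminf summable_mult summable_geometric) auto
    finally show "(\<Sum>i<n. a i powr (1 / Q)) \<le> S0 + (\<Sum>l. c * q ^ l)" .
  qed simp
qed

text \<open>Every point of the set lies in some level \<open>F k\<close> with
  \<open>k \<ge> k0\<close>, so covers of all these levels together cover it. Number of balls times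
  gauge is at most \<open>C * q ^ k\<close> at level \<open>k\<close>, and the tail of this series
  is as small as desired.\<close>

lemma gen_hausdorff_limsup_set_eq_0:
  fixes M :: "'a::metric_space measure" and f :: "'a \<Rightarrow> real"
  assumes balls: "\<And>x r. ball x r \<in> sets M" and sp: "space M = UNIV" and f: "integrable M f" "\<And>y. 0 \<le> f y"
    and "Q > 1" "\<epsilon> > 0"
  shows "gen_hausdorff (log_gauge Q \<epsilon>)
    {x. \<exists>\<^sub>\<infinity>k. 2 powr (- (real k * (Q - 1 + \<epsilon> / 2))) < (LINT y:ball x (exp (- (2 ^ k)))|M. f y)} = 0"
    (is "gen_hausdorff _ ?E = 0")
proof -
  define \<beta> where "\<beta> = Q - 1 + \<epsilon> / 2"
  define R :: "nat \<Rightarrow> real" where "R k = exp (- (2 ^ k))" for k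
  have "R k > 0" for k by (simp add: R_def)
  define F where "F k = {x. 2 powr (- (real k * \<beta>)) < (LINT y:ball x (R k)|M. f y)}" for k
  define I where "I = (LINT y|M. f y)"
  have fU: "set_integrable M UNIV f" using f by (simp add: set_integrable_def)
  have "I \<ge> 0" using f by (simp add: I_def)
  \<comment> \<open>Balls of radius \<open>R k\<close> about such points are disjoint and each takes
    more than \<open>2 powr (- (real k * \<beta>))\<close> of the total integral
    \<open>I\<close>.\<close>
  have bnd: "real (card P) \<le> I * 2 powr (real k * \<beta>)" if "finite P" "P \<subseteq> F k" "separated (2 * R k) P" for P k
  proof -
    have "real (card P) * 2 powr (- (real k * \<beta>)) = (\<Sum>p\<in>P. 2 powr (- (real k * \<beta>)))" by simp
    also have "\<dots> \<le> (\<Sum>p\<in>P. LINT y:ball p (R k)|M. f y)"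
      using that by (intro sum_mono) (auto simp: F_def)
    also have "\<dots> \<le> (LINT y:UNIV|M. f y)"
      using that disjoint_balls_separated[OF that(3)] balls
      by (intro sum_set_integral_le_disjoint fU f) auto
    also have "\<dots> = I" by (simp add: I_def set_lebesgue_integral_def)
    finally show ?thesis by (simp add: powr_minus field_simps)
  qed
  have "\<exists>P. finite P \<and> P \<subseteq> F k \<and> separated (2 * R k) P \<and> F k \<subseteq> (\<Union>p\<in>P. ball p (2 * R k))" for k
    using ex_maximal_separated[of "2 * R k" "F k" "I * 2 powr (real k * \<beta>)"] bnd \<open>R k > 0\<close>
    by (metis mult_pos_pos zero_less_numeral)
  then obtain P where P: "\<And>k. finite (P k)" "\<And>k. P k \<subseteq> F k" "\<And>k. separated (2 * R k) (P k)"
      "\<And>k. F k \<subseteq> (\<Union>p\<in>P k. ball p (2 * R k))" by metis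
  have "\<exists>e. e ` {0..<card (P k)} = P k" for k
    using ex_bij_betw_nat_finite[OF P(1)[of k]] by (auto simp: bij_betw_def)
  then obtain e where e: "\<And>k. e k ` {0..<card (P k)} = P k" by metis
  define C where "C = I * 2 powr (Q - 1 + \<epsilon>)"
  define q where "q = 2 powr (- \<epsilon> / 2)"
  have q: "0 < q" "q < 1" using \<open>\<epsilon> > 0\<close> by (auto simp: q_def powr_less_one)
  have "C \<ge> 0" using \<open>I \<ge> 0\<close> by (simp add: C_def)
  \<comment> \<open>For \<open>k \<ge> 2\<close> the term \<open>ln 4\<close> is at most half of
    \<open>2 ^ k\<close>, which explains the division by 2; the negative exponent turns this lower
    bound on the logarithm into an upper bound on the gauge.\<close>
  have gauge: "log_gauge Q \<epsilon> d \<le> (2 ^ k / 2) powr (1 - Q - \<epsilon>)" if "k \<ge> 2" "d \<le> 4 * R k" for k d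
  proof (cases "d \<le> 0")
    case False
    have "ln d \<le> ln (4 * R k)" using False that by simp
    also have "\<dots> = ln 4 - 2 ^ k" by (simp add: ln_mult R_def)
    finally have "2 ^ k - ln 4 \<le> ln (1 / d)" using False by (simp add: ln_div)
    moreover have "(2::real) ^ 2 \<le> 2 ^ k" using that by (intro power_increasing) auto
    moreover have "ln (4::real) \<le> 2"
      using ln_2_less_1 ln_powr[of 2 2] by (simp add: powr_numeral)
    ultimately have "2 ^ k / 2 \<le> ln (1 / d)" by simp
    then show ?thesis using False assms by (auto simp: log_gauge_def intro!: powr_mono2')
  qed (simp add: log_gauge_def)
  have level: "real (card (P k)) * (2 ^ k / 2) powr (1 - Q - \<epsilon>) \<le> C * q ^ k" for k
  proof -
    have "real (card (P k)) * (2 ^ k / 2) powr (1 - Q - \<epsilon>) \<le>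
        (I * 2 powr (real k * \<beta>)) * (2 ^ k / 2) powr (1 - Q - \<epsilon>)"
      using bnd[OF P(1,2,3)] by (intro mult_right_mono) auto
    also have "(2 ^ k / 2 :: real) = 2 powr (real k - 1)" by (simp add: powr_diff powr_realpow)
    also have "(I * 2 powr (real k * \<beta>)) * (2 powr (real k - 1)) powr (1 - Q - \<epsilon>) =
        I * 2 powr (real k * \<beta> + (real k - 1) * (1 - Q - \<epsilon>))"
      by (simp add: powr_powr powr_add)
    also have "real k * \<beta> + (real k - 1) * (1 - Q - \<epsilon>) = (Q - 1 + \<epsilon>) + (- \<epsilon> / 2) * real k"
      by (simp add: \<beta>_def algebra_simps)
    also have "I * 2 powr \<dots> = C * q ^ k"
      by (simp only: C_def q_def powr_add powr_powr[symmetric] mult.assoc) (simp add: powr_realpow)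
    finally show ?thesis by (simp add: powr_diff powr_realpow)
  qed
  have small: "hausdorff_delta (log_gauge Q \<epsilon>) \<delta> ?E \<le> ennreal \<eta>" if "\<delta> > 0" "\<eta> > 0" for \<delta> \<eta>
  proof -
    have "(\<lambda>k. 4 * R k) \<longlonglongrightarrow> 0" unfolding R_def by real_asymp
    then have "eventually (\<lambda>k. 4 * R k < \<delta>) sequentially"
      using that by (auto simp: order_tendsto_iff)
    moreover have "(\<lambda>k. C / (1 - q) * q ^ k) \<longlonglongrightarrow> 0"
      using q LIMSEQ_power_zero[of q] by (intro tendsto_mult_right_zero) auto
    then have "eventually (\<lambda>k. C / (1 - q) * q ^ k < \<eta>) sequentially"
      using that by (auto simp: order_tendsto_iff)
    ultimately have "eventually (\<lambda>k. 4 * R k < \<delta> \<and> C / (1 - q) * q ^ k < \<eta> \<and> k \<ge> 2) sequentially"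
      using eventually_ge_at_top[of 2] by eventually_elim auto
    then obtain k0 where k0: "\<And>k. k \<ge> k0 \<Longrightarrow> 4 * R k < \<delta> \<and> C / (1 - q) * q ^ k < \<eta> \<and> k \<ge> 2"
      by (auto simp: eventually_sequentially)
    \<comment> \<open>The content requires a single sequence of balls, so pairs (level, index) are
      flattened by \<open>prod_decode\<close>. Surplus indices at a level get radius 0: an empty
      ball, whose gauge is 0.\<close>
    define c where "c n = (case prod_decode n of (k, j) \<Rightarrow> e (k0 + k) j)" for n
    define r where "r n = (case prod_decode n of (k, j) \<Rightarrow> if j < card (P (k0 + k)) then 2 * R (k0 + k) else 0)" for n
    define T where "T = (\<lambda>(k, j). if j < card (P (k0 + k)) then (2 ^ (k0 + k) / 2) powr (1 - Q - \<epsilon>) else 0 :: real)"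
    have diam: "diameter (ball y (2 * R k)) \<le> 4 * R k" for y :: 'a and k
      using diameter_metric_ball_le[of "2 * R k" y] \<open>R k > 0\<close> by simp
    have "r n \<ge> 0 \<and> diameter (ball (c n) (r n)) \<le> \<delta>" for n
    proof -
      obtain k j where kj: "prod_decode n = (k, j)" by force
      show ?thesis using diam[of "c n" "k0 + k"] k0[of "k0 + k"] \<open>R (k0 + k) > 0\<close> \<open>\<delta> > 0\<close>
        by (auto simp: r_def kj)
    qed
    moreover have "?E \<subseteq> (\<Union>n. ball (c n) (r n))"
    proof
      fix x assume "x \<in> ?E"
      then obtain k where "k \<ge> k0" "x \<in> F k"
        by (auto simp: INFM_nat_le F_def R_def \<beta>_def)
      then obtain p where "p \<in> P k" "x \<in> ball p (2 * R k)" using P(4) by blast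
      then obtain j where "j < card (P k)" "x \<in> ball (e k j) (2 * R k)" using e[of k] by force
      then have "x \<in> ball (c (prod_encode (k - k0, j))) (r (prod_encode (k - k0, j)))"
        using \<open>k \<ge> k0\<close> by (simp add: c_def r_def)
      then show "x \<in> (\<Union>n. ball (c n) (r n))" by blast
    qed
    ultimately have "hausdorff_delta (log_gauge Q \<epsilon>) \<delta> ?E
        \<le> (\<Sum>n. ennreal (log_gauge Q \<epsilon> (diameter (ball (c n) (r n)))))"
      unfolding hausdorff_delta_def by (intro INF_lower2[of "(c, r)"]) auto
    also have "\<dots> \<le> (\<Sum>n. ennreal (T (prod_decode n)))"
    proof (intro suminf_le ennreal_leI)
      fix n
      obtain k j where kj: "prod_decode n = (k, j)" by force
      show "log_gauge Q \<epsilon> (diameter (ball (c n) (r n))) \<le> T (prod_decode n)"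
        using gauge[OF _ diam[of "c n" "k0 + k"]] k0[of "k0 + k"] by (auto simp: r_def T_def kj log_gauge_def)
    qed auto
    also have "\<dots> = (\<Sum>k. \<Sum>j. ennreal (T (k, j)))"
      by (rule suminf_ennreal_2dimen) simp
    also have "\<dots> \<le> (\<Sum>k. ennreal (C * q ^ k0 * q ^ k))"
    proof (intro suminf_le)
      fix k
      have "(\<Sum>j. ennreal (T (k, j))) = (\<Sum>j<card (P (k0 + k)). ennreal (T (k, j)))"
        by (rule suminf_finite) (auto simp: T_def)
      also have "\<dots> = ennreal (real (card (P (k0 + k))) * (2 ^ (k0 + k) / 2) powr (1 - Q - \<epsilon>))"
        by (simp add: T_def ennreal_mult ennreal_of_nat_eq_real_of_nat)
      also have "\<dots> \<le> ennreal (C * q ^ (k0 + k))"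
        by (intro ennreal_leI level)
      finally show "(\<Sum>j. ennreal (T (k, j))) \<le> ennreal (C * q ^ k0 * q ^ k)"
        by (simp add: power_add mult.assoc)
    qed auto
    also have "\<dots> = ennreal (\<Sum>k. C * q ^ k0 * q ^ k)"
      using q \<open>C \<ge> 0\<close> by (intro suminf_ennreal2 summable_mult summable_geometric) auto
    also have "(\<Sum>k. C * q ^ k0 * q ^ k) = C / (1 - q) * q ^ k0"
      using q by (subst suminf_mult) (auto simp: suminf_geometric summable_geometric)
    also have "ennreal \<dots> \<le> ennreal \<eta>" using k0[of k0] by (intro ennreal_leI) auto
    finally show ?thesis .
  qed
  have "hausdorff_delta (log_gauge Q \<epsilon>) \<delta> ?E = 0" if "\<delta> > 0" for \<delta>
  proof -
    have "hausdorff_delta (log_gauge Q \<epsilon>) \<delta> ?E \<le> 0"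
      by (rule ennreal_le_epsilon) (use small[OF that] in auto)
    then show ?thesis by simp
  qed
  then have "eventually (\<lambda>\<delta>. hausdorff_delta (log_gauge Q \<epsilon>) \<delta> ?E = 0) (at_right 0)"
    by (rule eventually_mono[OF eventually_at_right_less])
  then have "Limsup (at_right 0) (\<lambda>\<delta>. hausdorff_delta (log_gauge Q \<epsilon>) \<delta> ?E) = Limsup (at_right (0::real)) (\<lambda>_. 0)"
    by (rule Limsup_eq)
  then show ?thesis by (simp add: gen_hausdorff_def Limsup_const)
qed

section \<open>Oscillation under the Poincare inequality\<close>

lemma dist_le_infdist_plus_diameter:
  fixes x :: "'a::metric_space"
  assumes "bounded B" "y \<in> B"
  shows "dist x y \<le> infdist x B + diameter B"
proof -
  have "dist x y - diameter B \<le> dist x z" if "z \<in> B" for z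
    using diameter_bounded_bound[OF assms(1) that assms(2)] dist_triangle[of x y z] by linarith
  then have "dist x y - diameter B \<le> infdist x B"
    using assms(2) by (auto simp: infdist_def intro!: cINF_greatest)
  then show ?thesis by simp
qed

lemma convergent_if_summable_increments:
  fixes f :: "nat \<Rightarrow> real"
  assumes "summable (\<lambda>i. f (Suc i) - f i)"
  shows "convergent f"
proof -
  have "(\<lambda>n. f 0 + (\<Sum>i<n. f (Suc i) - f i)) \<longlonglongrightarrow> f 0 + (\<Sum>i. f (Suc i) - f i)"
    using summable_LIMSEQ[OF assms] by (intro tendsto_intros)
  then show ?thesis by (auto simp: sum_lessThan_telescope convergent_def)
qed

lemma Markov_inequality_set_integral:
  fixes h :: "'b \<Rightarrow> real"
  assumes "S \<in> sets M" "B \<in> fmeasurable M" "set_integrable M B h"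
    and "\<And>y. y \<in> B \<Longrightarrow> 0 \<le> h y" "\<And>y. y \<in> S \<inter> B \<Longrightarrow> \<kappa> \<le> h y"
  shows "\<kappa> * measure M (S \<inter> B) \<le> (LINT y:B|M. h y)"
proof -
  have SB: "S \<inter> B \<in> fmeasurable M"
    by (rule fmeasurableI2[OF assms(2)]) (use assms in \<open>auto simp: fmeasurable_def\<close>)
  then have int: "integrable M (\<lambda>y. indicator (S \<inter> B) y * \<kappa>)"
    by (auto simp: fmeasurable_def)
  have "\<kappa> * measure M (S \<inter> B) = (LINT y|M. indicator (S \<inter> B) y * \<kappa>)"
    using SB by (simp add: fmeasurable_def)
  also have "\<dots> \<le> (LINT y|M. indicator B y *\<^sub>R h y)"
    using assms(3-5)
    by (intro integral_mono int) (auto simp: set_integrable_def indicator_def)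
  finally show ?thesis by (simp add: set_lebesgue_integral_def)
qed

text \<open>\<open>f\<close> stands for \<open>g powr Q\<close>, so that membership of
  \<open>g\<close> in the Lebesgue space of exponent \<open>Q\<close> becomes integrability of
  \<open>f\<close>.\<close>

locale poincare_space = doubling_measure M
  for M :: "'a::metric_space measure" +
  fixes Q C lam :: real and u f :: "'a \<Rightarrow> real"
  assumes Q: "Q > 1" and Q_doubling: "Q_doubling M Q"
    and u: "\<And>x r. r > 0 \<Longrightarrow> set_integrable M (ball x r) u"
    and f: "integrable M f" and f_nonneg: "\<And>y. 0 \<le> f y"
    and C: "C > 0" and lam: "lam \<ge> 1"
    and poincare: "\<And>x r. r > 0 \<Longrightarrow> avg M (\<lambda>y. \<bar>u y - avg M u (ball x r)\<bar>) (ball x r)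
      \<le> C * diameter (ball x r) * avg M f (ball x (lam * r)) powr (1 / Q)"
begin

definition osc :: "'a set \<Rightarrow> real" where
  "osc B = avg M (\<lambda>y. \<bar>u y - avg M u B\<bar>) B"

definition energy :: "'a set \<Rightarrow> real" where
  "energy A = (LINT y:A|M. f y)"

lemma f_set_integrable: "A \<in> sets M \<Longrightarrow> set_integrable M A f"
  using integrable_mult_indicator[OF _ f] by (simp add: set_integrable_def)

lemma energy_nonneg: "0 \<le> energy A"
  unfolding energy_def set_lebesgue_integral_def using f_nonneg by (intro integral_nonneg_AE) auto

lemma energy_mono:
  assumes "A \<in> sets M" "B \<in> sets M" "A \<subseteq> B"
  shows "energy A \<le> energy B"
  unfolding energy_def set_lebesgue_integral_def
proof (rule integral_mono)
  show "integrable M (\<lambda>y. indicat_real A y *\<^sub>R f y)" "integrable M (\<lambda>y. indicat_real B y *\<^sub>R f y)"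
    using f_set_integrable assms by (simp_all add: set_integrable_def)
  show "indicat_real A y *\<^sub>R f y \<le> indicat_real B y *\<^sub>R f y" for y
    using assms f_nonneg[of y] by (simp add: indicator_def subset_iff)
qed

lemma osc_nonneg: "0 \<le> osc B"
  unfolding osc_def avg_def set_lebesgue_integral_def
  by (intro divide_nonneg_nonneg integral_nonneg_AE) auto

lemma osc_integral:
  assumes "r > 0"
  shows "set_integrable M (ball x r) (\<lambda>y. \<bar>u y - c\<bar>)"
    "(LINT y:ball x r|M. \<bar>u y - avg M u (ball x r)\<bar>) = osc (ball x r) * measure M (ball x r)"
proof -
  have "set_integrable M (ball x r) (\<lambda>_. c)"
    using emeasure_ball_finite unfolding set_integrable_def
    by (auto intro!: integrable_scaleR_left)
  then show "set_integrable M (ball x r) (\<lambda>y. \<bar>u y - c\<bar>)"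
    using u[OF assms] by (intro set_integrable_abs set_integral_diff(1))
  show "(LINT y:ball x r|M. \<bar>u y - avg M u (ball x r)\<bar>) = osc (ball x r) * measure M (ball x r)"
    using measure_ball_pos[OF assms] by (simp add: osc_def avg_def less_imp_neq[symmetric])
qed

text \<open>The lower mass bound makes the average of \<open>f\<close> at most a multiple of energy
  over \<open>t powr Q\<close>; after the \<open>Q\<close>-th root the factor \<open>t\<close>
  cancels against the diameter in the Poincare inequality, leaving no power of the radius.\<close>

lemma osc_le_energy:
  obtains K where "K \<ge> 0"
    "\<And>c t. dist x c < 1 \<Longrightarrow> 0 < t \<Longrightarrow> t \<le> 1 \<Longrightarrow> osc (ball c t) \<le> K * energy (ball c (lam * t)) powr (1 / Q)"
proof -
  obtain C0 where C0: "C0 \<ge> 1" "\<And>a x r s. x \<in> ball a r \<Longrightarrow> 0 < s \<Longrightarrow> s \<le> r \<Longrightarrow>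
      (s / r) powr Q \<le> C0 * measure M (ball x s) / measure M (ball a r)"
    using Q_doubling unfolding Q_doubling_def by blast
  \<comment> \<open>The \<open>Q\<close>-doubling condition is applied relative to
    \<open>ball x 1\<close>, hence the restrictions to centres within 1 of \<open>x\<close> and to
    radii at most 1. The constant depends on \<open>x\<close>.\<close>
  define \<kappa> where "\<kappa> = measure M (ball x 1) / C0"
  have "\<kappa> > 0" using C0 measure_ball_pos[of 1 x] by (simp add: \<kappa>_def)
  have low: "\<kappa> * t powr Q \<le> measure M (ball c t)" if "dist x c < 1" "0 < t" "t \<le> 1" for c t
    using C0(2)[of c x 1 t] that C0(1) measure_ball_pos[of 1 x] by (simp add: \<kappa>_def field_simps)
  show thesis
  proof
    show "0 \<le> 2 * C * \<kappa> powr (- 1 / Q)" using C by simp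
    fix c and t :: real assume t: "dist x c < 1" "0 < t" "t \<le> 1"
    have "t \<le> lam * t" using t lam by simp
    have "\<kappa> * t powr Q \<le> measure M (ball c (lam * t))"
      using low[OF t] measure_mono_ball[OF ball_sets, of c t c "lam * t"] subset_ball[OF \<open>t \<le> lam * t\<close>]
      by (meson order_trans)
    then have "avg M f (ball c (lam * t)) \<le> energy (ball c (lam * t)) / (\<kappa> * t powr Q)"
      using energy_nonneg \<open>\<kappa> > 0\<close> t unfolding avg_def energy_def[symmetric]
      by (intro divide_left_mono) (auto intro!: mult_pos_pos measure_ball_pos simp: lam less_le_trans[OF _ lam])
    then have "avg M f (ball c (lam * t)) powr (1 / Q) \<le> (energy (ball c (lam * t)) / (\<kappa> * t powr Q)) powr (1 / Q)"
      using Q energy_nonneg unfolding avg_def energy_def[symmetric] by (intro powr_mono2) auto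
    also have "\<dots> = energy (ball c (lam * t)) powr (1 / Q) * \<kappa> powr (- 1 / Q) / t"
      using \<open>\<kappa> > 0\<close> t Q energy_nonneg
      by (simp add: powr_divide powr_mult powr_powr powr_minus_divide)
    finally have *: "avg M f (ball c (lam * t)) powr (1 / Q) \<le> energy (ball c (lam * t)) powr (1 / Q) * \<kappa> powr (- 1 / Q) / t" .
    have "osc (ball c t) \<le> C * diameter (ball c t) * avg M f (ball c (lam * t)) powr (1 / Q)"
      unfolding osc_def by (rule poincare[OF t(2)])
    also have "\<dots> \<le> C * (2 * t) * (energy (ball c (lam * t)) powr (1 / Q) * \<kappa> powr (- 1 / Q) / t)"
      using C t diameter_metric_ball_le[of t c] by (intro mult_mono * mult_left_mono) auto
    also have "\<dots> = 2 * C * \<kappa> powr (- 1 / Q) * energy (ball c (lam * t)) powr (1 / Q)"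
      using t by simp
    finally show "osc (ball c t) \<le> 2 * C * \<kappa> powr (- 1 / Q) * energy (ball c (lam * t)) powr (1 / Q)" .
  qed
qed

text \<open>The threshold is \<open>ln (1 / r) powr (- (Q - 1 + \<gamma>))\<close> at
  \<open>r = exp (- (2 ^ k))\<close>; along these radii the logarithm doubles.\<close>

definition exceptional :: "real \<Rightarrow> 'a set" where
  "exceptional \<gamma> = {x. \<exists>\<^sub>\<infinity>k. 2 powr (- (real k * (Q - 1 + \<gamma>))) < energy (ball x (exp (- (2 ^ k))))}"

lemma not_exceptionalE:
  assumes "x \<notin> exceptional \<gamma>"
  obtains k0 where "\<And>k. k \<ge> k0 \<Longrightarrow> energy (ball x (exp (- (2 ^ k)))) \<le> 2 powr (- (real k * (Q - 1 + \<gamma>)))"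
  using assms by (auto simp: exceptional_def INFM_nat_le not_less)

text \<open>The thresholds tend to 0 and energy is monotone in the radius, so one good scale
  \<open>k\<close> controls all smaller balls; \<open>osc_le_energy\<close> transfers this to the
  oscillation.\<close>

lemma osc_tendsto_0:
  assumes "x \<notin> exceptional \<gamma>" "\<gamma> > 0"
  shows "((\<lambda>r. osc (ball x r)) \<longlongrightarrow> 0) (at_right 0)"
proof -
  obtain k0 where k0: "\<And>k. k \<ge> k0 \<Longrightarrow> energy (ball x (exp (- (2 ^ k)))) \<le> 2 powr (- (real k * (Q - 1 + \<gamma>)))"
    using not_exceptionalE[OF assms(1)] by metis
  have lim0: "(\<lambda>k. 2 powr (- (real k * (Q - 1 + \<gamma>)))) \<longlonglongrightarrow> 0"
  proof -
    have "(\<lambda>k. (2 powr (- (Q - 1 + \<gamma>))) ^ k) \<longlonglongrightarrow> 0"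
      using Q assms(2) by (intro LIMSEQ_power_zero) (auto simp: powr_less_one)
    moreover have "2 powr (- (real k * (Q - 1 + \<gamma>))) = (2 powr (- (Q - 1 + \<gamma>))) ^ k" for k
    proof -
      have "- (real k * (Q - 1 + \<gamma>)) = - (Q - 1 + \<gamma>) * real k" by (simp add: algebra_simps)
      then show ?thesis by (simp only: powr_powr[symmetric]) (simp add: powr_realpow)
    qed
    ultimately show ?thesis by simp
  qed
  have "((\<lambda>r. energy (ball x (lam * r))) \<longlongrightarrow> 0) (at_right 0)"
  proof (rule order_tendstoI)
    fix a :: real assume "a < 0"
    then show "\<forall>\<^sub>F r in at_right 0. a < energy (ball x (lam * r))"
      by (intro always_eventually allI less_le_trans[OF _ energy_nonneg])
  next
    fix a :: real assume "0 < a"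
    then have "eventually (\<lambda>k. 2 powr (- (real k * (Q - 1 + \<gamma>))) < a \<and> k \<ge> k0) sequentially"
      by (intro eventually_conj order_tendstoD(2)[OF lim0] eventually_ge_at_top)
    then obtain k where k: "2 powr (- (real k * (Q - 1 + \<gamma>))) < a" "k \<ge> k0"
      using eventually_happens'[OF sequentially_bot] by blast
    have "energy (ball x (lam * r)) < a" if "r < exp (- (2 ^ k)) / lam" for r
    proof -
      have "lam * r \<le> exp (- (2 ^ k))" using that lam by (simp add: field_simps)
      then have "energy (ball x (lam * r)) \<le> energy (ball x (exp (- (2 ^ k))))"
        by (intro energy_mono subset_ball) auto
      with k0[OF k(2)] k(1) show ?thesis by linarith
    qed
    moreover have "eventually (\<lambda>r. r < exp (- (2 ^ k)) / lam) (at_right 0)"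
      by (rule order_tendstoD(2)[OF tendsto_ident_at]) (use lam in simp)
    ultimately show "\<forall>\<^sub>F r in at_right 0. energy (ball x (lam * r)) < a"
      by (rule eventually_mono[rotated])
  qed
  then have lim1: "((\<lambda>r. energy (ball x (lam * r)) powr (1 / Q)) \<longlongrightarrow> 0) (at_right 0)"
    by (rule tendsto_zero_powrI[OF _ tendsto_const]) (use Q energy_nonneg in simp_all)
  obtain K where K: "K \<ge> 0"
    "\<And>c t. dist x c < 1 \<Longrightarrow> 0 < t \<Longrightarrow> t \<le> 1 \<Longrightarrow> osc (ball c t) \<le> K * energy (ball c (lam * t)) powr (1 / Q)"
    using osc_le_energy[of x] by metis
  have "eventually (\<lambda>r::real. 0 < r \<and> r < 1) (at_right 0)"
    by (intro eventually_conj eventually_at_right_less order_tendstoD(2)[OF tendsto_ident_at] zero_less_one)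
  then have le: "eventually (\<lambda>r. osc (ball x r) \<le> K * energy (ball x (lam * r)) powr (1 / Q)) (at_right 0)"
    by (rule eventually_mono) (use K(2) in simp)
  have lim: "((\<lambda>r. K * energy (ball x (lam * r)) powr (1 / Q)) \<longlongrightarrow> 0) (at_right 0)"
    using lim1 by (rule tendsto_mult_right_zero)
  show ?thesis
    by (rule tendsto_sandwich[OF _ le tendsto_const lim]) (simp add: osc_nonneg)
qed

section \<open>Almost everywhere identification of the limit with \<open>u\<close>\<close>

text \<open>Once the average is within \<open>\<kappa>\<close> of \<open>v\<close>, points of
  \<open>S\<close> still deviate from it by \<open>\<kappa>\<close>, half of the assumed gap, and
  Markov bounds the density by \<open>osc (ball x r) / \<kappa>\<close>.\<close>

lemma density_tendsto_0:
  assumes S: "S \<in> sets M" and "\<kappa> > 0" "\<And>y. y \<in> S \<Longrightarrow> 2 * \<kappa> \<le> \<bar>u y - v\<bar>"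
    and v: "((\<lambda>r. avg M u (ball x r)) \<longlongrightarrow> v) (at_right 0)"
    and o: "((\<lambda>r. osc (ball x r)) \<longlongrightarrow> 0) (at_right 0)"
  shows "((\<lambda>r. measure M (S \<inter> ball x r) / measure M (ball x r)) \<longlongrightarrow> 0) (at_right 0)"
proof -
  have "eventually (\<lambda>r. dist (avg M u (ball x r)) v < \<kappa>) (at_right 0)"
    using tendstoD[OF v \<open>\<kappa> > 0\<close>] .
  then have le: "eventually (\<lambda>r. measure M (S \<inter> ball x r) / measure M (ball x r) \<le> osc (ball x r) / \<kappa>) (at_right 0)"
    using eventually_at_right_less[of "0::real"]
  proof eventually_elim
    case (elim r)
    have "\<kappa> * measure M (S \<inter> ball x r) \<le> (LINT y:ball x r|M. \<bar>u y - avg M u (ball x r)\<bar>)"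
    proof (rule Markov_inequality_set_integral[OF S ball_fmeasurable osc_integral(1)[OF elim(2)]])
      fix y assume "y \<in> S \<inter> ball x r"
      then show "\<kappa> \<le> \<bar>u y - avg M u (ball x r)\<bar>"
        using assms(3)[of y] elim(1) unfolding dist_real_def by auto
    qed simp
    also have "\<dots> = osc (ball x r) * measure M (ball x r)"
      by (rule osc_integral(2)[OF elim(2)])
    finally show ?case
      using measure_ball_pos[OF elim(2), of x] \<open>\<kappa> > 0\<close> by (simp add: field_simps)
  qed
  have lim: "((\<lambda>r. osc (ball x r) / \<kappa>) \<longlongrightarrow> 0) (at_right 0)"
    by (rule tendsto_divide_zero[OF o])
  show ?thesis
    by (rule tendsto_sandwich[OF _ le tendsto_const lim]) simp
qed

lemma u_measurable: "u \<in> borel_measurable M"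
proof -
  obtain x0 :: 'a where True by simp
  show ?thesis
  proof (rule borel_measurable_LIMSEQ_real)
    fix y
    obtain N where "dist x0 y < real N" using reals_Archimedean2 by blast
    then have "indicator (ball x0 (real (Suc n))) y *\<^sub>R u y = u y" if "n \<ge> N" for n
      using that by simp
    then have "eventually (\<lambda>n. indicator (ball x0 (real (Suc n))) y *\<^sub>R u y = u y) sequentially"
      by (rule eventually_sequentiallyI)
    then show "(\<lambda>n. indicator (ball x0 (real (Suc n))) y *\<^sub>R u y) \<longlonglongrightarrow> u y"
      by (rule tendsto_eventually)
  next
    fix n
    show "(\<lambda>y. indicator (ball x0 (real (Suc n))) y *\<^sub>R u y) \<in> borel_measurable M"
      using u[of "real (Suc n)" x0] by (auto simp: set_integrable_def)
  qed
qed

text \<open>If \<open>v\<close> differed from \<open>u x\<close>, a rational strictly between them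
  would put \<open>x\<close> in a level set of \<open>u\<close> on which \<open>u\<close> stays away
  from \<open>v\<close>. That set would have density 0 at its own point \<open>x\<close>, which is
  excluded off a null set for all countably many rationals.\<close>

lemma AE_limit_eq:
  "AE x in M. \<forall>v. ((\<lambda>r. avg M u (ball x r)) \<longlongrightarrow> v) (at_right 0) \<longrightarrow>
     ((\<lambda>r. osc (ball x r)) \<longlongrightarrow> 0) (at_right 0) \<longrightarrow> v = u x"
proof -
  let ?dens = "\<lambda>S x r. measure M (S \<inter> ball x r) / measure M (ball x r)"
  define lo hi where "lo q = {y. u y < real_of_rat q}" and "hi q = {y. u y > real_of_rat q}" for q
  have S: "lo q \<in> sets M" "hi q \<in> sets M" for q
    using measurable_sets[OF u_measurable, of "{..<real_of_rat q}"]
      measurable_sets[OF u_measurable, of "{real_of_rat q<..}"]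
    by (simp_all add: lo_def hi_def space_M vimage_def)
  have "AE x in M. \<forall>q. (x \<in> lo q \<longrightarrow> \<not> (?dens (lo q) x \<longlongrightarrow> 0) (at_right 0)) \<and>
      (x \<in> hi q \<longrightarrow> \<not> (?dens (hi q) x \<longlongrightarrow> 0) (at_right 0))"
    unfolding AE_all_countable
    by (intro allI AE_conjI AE_not_zero_density[OF S(1)] AE_not_zero_density[OF S(2)])
  then show ?thesis
  proof (rule AE_mp, intro AE_I2 impI allI)
    fix x v
    assume dens: "\<forall>q. (x \<in> lo q \<longrightarrow> \<not> (?dens (lo q) x \<longlongrightarrow> 0) (at_right 0)) \<and>
        (x \<in> hi q \<longrightarrow> \<not> (?dens (hi q) x \<longlongrightarrow> 0) (at_right 0))"
      and v: "((\<lambda>r. avg M u (ball x r)) \<longlongrightarrow> v) (at_right 0)"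
      and o: "((\<lambda>r. osc (ball x r)) \<longlongrightarrow> 0) (at_right 0)"
    show "v = u x"
    proof (rule ccontr)
      assume "v \<noteq> u x"
      then consider "u x < v" | "v < u x" by linarith
      then show False
      proof cases
        case 1
        then obtain q where q: "u x < real_of_rat q" "real_of_rat q < v" using of_rat_dense by blast
        have lim: "(?dens (lo q) x \<longlongrightarrow> 0) (at_right 0)"
          using q by (intro density_tendsto_0[OF S(1) _ _ v o, of "(v - real_of_rat q) / 2"]) (auto simp: lo_def)
        have "x \<in> lo q" using q by (simp add: lo_def)
        then show False using lim notE[OF mp[OF dens[THEN spec[of _ q], THEN conjunct1]]] by iprover
      next
        case 2
        then obtain q where q: "v < real_of_rat q" "real_of_rat q < u x" using of_rat_dense by blast
        have lim: "(?dens (hi q) x \<longlongrightarrow> 0) (at_right 0)"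
          using q by (intro density_tendsto_0[OF S(2) _ _ v o, of "(real_of_rat q - v) / 2"]) (auto simp: hi_def)
        have "x \<in> hi q" using q by (simp add: hi_def)
        then show False using lim notE[OF mp[OF dens[THEN spec[of _ q], THEN conjunct2]]] by iprover
      qed
    qed
  qed
qed

end

section \<open>Convergence along chains of balls\<close>

text \<open>A chain towards \<open>x\<close> whose overlap is controlled for the dilation
  \<open>lam\<close> of the Poincare inequality; \<open>nonisolated\<close> prevents a chain ball
  from shrinking to \<open>{x}\<close>.\<close>

locale poincare_chain = poincare_space M Q C lam u f
  for M :: "'a::metric_space measure" and Q C lam :: real and u f :: "'a \<Rightarrow> real" +
  fixes x :: 'a and c :: "nat \<Rightarrow> 'a" and \<rho> :: "nat \<Rightarrow> real" and Mc R m :: real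
  assumes Mc: "Mc \<ge> 1" and m: "m > 0" and R: "R > 0"
    and nonisolated: "\<And>r. r > 0 \<Longrightarrow> ball x r \<noteq> {x}"
    and rho: "\<And>i. \<rho> i > 0"
    and diameter_le: "\<And>i. diameter (ball (c i) (\<rho> i)) / Mc \<le> infdist x (ball (c i) (\<rho> i))"
    and infdist_le: "\<And>i. infdist x (ball (c i) (\<rho> i)) \<le> Mc * diameter (ball (c i) (\<rho> i))"
    and decay: "\<And>i. infdist x (ball (c i) (\<rho> i)) \<le> Mc * R * 2 powr (- m * real i)"
    and link: "\<And>i. \<exists>d s. s > 0 \<and> ball d s \<subseteq> ball (c i) (\<rho> i) \<inter> ball (c (Suc i)) (\<rho> (Suc i)) \<and>
        ball (c i) (\<rho> i) \<union> ball (c (Suc i)) (\<rho> (Suc i)) \<subseteq> ball d (Mc * s)"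
    and overlap: "\<And>y. finite {i. y \<in> ball (c i) (lam * \<rho> i)}"
      "\<And>y. real (card {i. y \<in> ball (c i) (lam * \<rho> i)}) \<le> Mc"
begin

abbreviation B :: "nat \<Rightarrow> 'a set" where
  "B i \<equiv> ball (c i) (\<rho> i)"

lemma center: "c i \<in> B i"
  using rho by simp

lemma dist_le: "y \<in> B i \<Longrightarrow> dist x y \<le> infdist x (B i) + diameter (B i)"
  by (intro dist_le_infdist_plus_diameter) auto

lemma diameter_le': "diameter (B i) \<le> Mc * infdist x (B i)"
  using diameter_le[of i] Mc by (simp add: field_simps)

text \<open>Distance 0 forces diameter 0, hence \<open>B i = {x}\<close>. Positivity is what later
  lets small balls about \<open>x\<close> miss any given number of initial chain balls.\<close>

lemma infdist_pos: "0 < infdist x (B i)"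
proof (rule ccontr)
  assume "\<not> 0 < infdist x (B i)"
  then have 0: "infdist x (B i) = 0" using infdist_nonneg[of x "B i"] by linarith
  then have "diameter (B i) \<le> 0" using diameter_le'[of i] by simp
  then have "y = x" if "y \<in> B i" for y
    using order_trans[OF dist_le[OF that], of 0] 0 by simp
  then have "B i = {x}" "c i = x" using center[of i] by blast+
  with nonisolated[OF rho[of i]] show False by simp
qed

lemma diameter_pos: "0 < diameter (B i)"
  using infdist_le[of i] infdist_pos[of i] Mc by (smt (verit) mult_nonneg_nonpos)

text \<open>A radius may exceed the diameter of its ball by an arbitrary factor. Cutting it down to twice
  the diameter does not change the ball, but keeps the enlarged ball close to \<^term>\<open>x\<close>.\<close>

definition t :: "nat \<Rightarrow> real" where
  "t i = min (\<rho> i) (2 * diameter (B i))"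

lemma t_pos: "0 < t i"
  using rho diameter_pos by (simp add: t_def)

lemma ball_t: "ball (c i) (t i) = B i"
proof
  show "B i \<subseteq> ball (c i) (t i)"
  proof
    fix y assume "y \<in> B i"
    then have "dist (c i) y \<le> diameter (B i)"
      using diameter_bounded_bound[OF bounded_ball center] by blast
    then show "y \<in> ball (c i) (t i)" using \<open>y \<in> B i\<close> diameter_pos[of i] by (simp add: t_def)
  qed
qed (auto simp: t_def)

text \<open>The bracket adds the distance to \<open>x\<close>, the diameter and the dilated cut-down
  radius, in units of the distance; the maximum with 1 makes \<open>ln C0\<close>
  nonnegative.\<close>

definition C0 :: real where
  "C0 = max 1 (Mc * R * (1 + Mc + 2 * lam * Mc))"

definition w :: "nat \<Rightarrow> real" where
  "w i = C0 * 2 powr (- m * real i)"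

lemma reach: "infdist x (B i) + diameter (B i) + 2 * lam * diameter (B i) \<le> w i"
proof -
  have "infdist x (B i) + diameter (B i) + 2 * lam * diameter (B i)
      \<le> infdist x (B i) + Mc * infdist x (B i) + 2 * lam * (Mc * infdist x (B i))"
    using diameter_le'[of i] lam by (intro add_mono mult_left_mono) auto
  also have "\<dots> = infdist x (B i) * (1 + Mc + 2 * lam * Mc)" by (simp add: algebra_simps)
  also have "\<dots> \<le> (Mc * R * 2 powr (- m * real i)) * (1 + Mc + 2 * lam * Mc)"
    using decay[of i] Mc lam by (intro mult_right_mono) auto
  also have "\<dots> = (Mc * R * (1 + Mc + 2 * lam * Mc)) * 2 powr (- m * real i)" by simp
  also have "\<dots> \<le> w i" unfolding w_def C0_def by (intro mult_right_mono) auto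
  finally show ?thesis .
qed

lemma w_tendsto_0: "w \<longlonglongrightarrow> 0"
proof -
  have "(\<lambda>i. (2 powr (- m)) ^ i) \<longlonglongrightarrow> 0"
    using m by (intro LIMSEQ_power_zero) (auto simp: powr_less_one)
  moreover have "(2 powr (- m)) ^ i = 2 powr (- m * real i)" for i
    using powr_powr[of 2 "- m" "real i"] by (simp add: powr_realpow)
  ultimately have "(\<lambda>i. 2 powr (- m * real i)) \<longlonglongrightarrow> 0" by simp
  then show ?thesis unfolding w_def by (rule tendsto_mult_right_zero)
qed

lemma enlarged_ball_subset: "ball (c i) (lam * t i) \<subseteq> ball x (w i)"
proof
  fix y assume "y \<in> ball (c i) (lam * t i)"
  moreover have "lam * t i \<le> lam * (2 * diameter (B i))"
    using lam by (intro mult_left_mono) (auto simp: t_def)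
  ultimately have "dist (c i) y < 2 * lam * diameter (B i)" by simp
  then show "y \<in> ball x (w i)"
    using dist_le[OF center, of i] dist_triangle[of x y "c i"] reach[of i] by simp
qed

text \<open>The radii \<open>w i\<close> decay geometrically, so the block of indices from
  \<open>A * 2 ^ k\<close> on lies within \<open>exp (- (2 ^ k))\<close> of \<open>x\<close>, where
  nonexceptionality bounds the energy and bounded overlap bounds the block sum.\<close>

lemma summable_energy:
  assumes x: "x \<notin> exceptional \<gamma>" and "\<gamma> > 0"
  shows "summable (\<lambda>i. energy (ball (c i) (lam * t i)) powr (1 / Q))"
proof -
  obtain k0 where k0: "\<And>k. k \<ge> k0 \<Longrightarrow> energy (ball x (exp (- (2 ^ k)))) \<le> 2 powr (- (real k * (Q - 1 + \<gamma>)))"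
    using not_exceptionalE[OF x] by metis
  \<comment> \<open>Chosen so that \<open>ln C0 - m * real i * ln 2\<close>, the logarithm of
    \<open>w i\<close>, is at most \<open>- (2 ^ k)\<close> once
    \<open>i \<ge> A * 2 ^ k\<close>.\<close>
  obtain A where A: "(1 + ln C0) / (m * ln 2) < real A" using reals_Archimedean2 by blast
  have "C0 \<ge> 1" by (simp add: C0_def)
  have mln: "m * ln 2 > 0" using m by simp
  have A1: "1 + ln C0 \<le> real A * (m * ln 2)" using A mln by (simp add: pos_divide_less_eq)
  have "A > 0"
  proof (rule ccontr)
    assume "\<not> A > 0"
    then show False using A1 ln_ge_zero[OF \<open>C0 \<ge> 1\<close>] by simp
  qed
  have small: "w i \<le> exp (- (2 ^ k))" if "A * 2 ^ k \<le> i" for i k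
  proof -
    have "2 ^ k + ln C0 \<le> 2 ^ k * (1 + ln C0)"
      using mult_right_mono[of 1 "2 ^ k" "ln C0"] ln_ge_zero[OF \<open>C0 \<ge> 1\<close>] by (simp add: algebra_simps)
    also have "\<dots> \<le> 2 ^ k * (real A * (m * ln 2))"
      using A1 by (intro mult_left_mono) auto
    also have "\<dots> = real (A * 2 ^ k) * (m * ln 2)" by simp
    also have "\<dots> \<le> real i * (m * ln 2)"
      using that mln by (intro mult_right_mono of_nat_mono) auto
    finally have "ln C0 - m * real i * ln 2 \<le> - (2 ^ k)" by (simp add: algebra_simps)
    moreover have "w i = exp (ln C0 - m * real i * ln 2)"
      using \<open>C0 \<ge> 1\<close> by (simp add: w_def powr_def exp_diff exp_minus field_simps)
    ultimately show ?thesis by simp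
  qed
  show ?thesis
  proof (rule summable_powr_dyadic_blocks[OF energy_nonneg Q \<open>\<gamma> > 0\<close> \<open>A > 0\<close>])
    show "Mc > 0" using Mc by simp
    fix k assume "k \<ge> k0"
    let ?I = "{A * 2 ^ k..<A * 2 ^ Suc k}"
    have "(\<Sum>i\<in>?I. energy (ball (c i) (lam * t i))) \<le> Mc * energy (ball x (exp (- (2 ^ k))))"
      unfolding energy_def
    proof (rule sum_set_integral_le_overlap)
      fix i assume "i \<in> ?I"
      then have "ball x (w i) \<subseteq> ball x (exp (- (2 ^ k)))" using small by (intro subset_ball) auto
      then show "ball (c i) (lam * t i) \<subseteq> ball x (exp (- (2 ^ k)))"
        using enlarged_ball_subset[of i] by blast
    next
      fix y
      have "ball (c i) (lam * t i) \<subseteq> ball (c i) (lam * \<rho> i)" for i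
        using lam by (intro subset_ball mult_left_mono) (auto simp: t_def)
      then have "card {i \<in> ?I. y \<in> ball (c i) (lam * t i)} \<le> card {i. y \<in> ball (c i) (lam * \<rho> i)}"
        by (intro card_mono overlap) blast
      then show "real (card {i \<in> ?I. y \<in> ball (c i) (lam * t i)}) \<le> Mc"
        using overlap(2)[of y] by linarith
    qed (simp_all add: f_nonneg f_set_integrable)
    also have "\<dots> \<le> Mc * 2 powr (- (real k * (Q - 1 + \<gamma>)))"
      using k0[OF \<open>k \<ge> k0\<close>] Mc by (intro mult_left_mono) auto
    finally show "(\<Sum>i\<in>?I. energy (ball (c i) (lam * t i))) \<le> Mc * 2 powr (- (real k * (Q - 1 + \<gamma>)))" .
  qed
qed

text \<open>Neighbouring averages are both compared with the average over the link ball in the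
  intersection, which has comparable measure; the two oscillations are then summable by
  \<open>summable_energy\<close>.\<close>

lemma convergent_avg_chain:
  assumes x: "x \<notin> exceptional \<gamma>" and "\<gamma> > 0"
  shows "convergent (\<lambda>i. avg M u (B i))"
proof (rule convergent_if_summable_increments)
  obtain K where K: "K \<ge> 0"
    "\<And>c t. dist x c < 1 \<Longrightarrow> 0 < t \<Longrightarrow> t \<le> 1 \<Longrightarrow> osc (ball c t) \<le> K * energy (ball c (lam * t)) powr (1 / Q)"
    using osc_le_energy[of x] by metis
  define b where "b i = energy (ball (c i) (lam * t i)) powr (1 / Q)" for i
  have b: "summable b" unfolding b_def using summable_energy[OF assms] .
  obtain D where D: "D \<ge> 1" "\<And>x y r s. s > 0 \<Longrightarrow> r \<le> Mc * s \<Longrightarrow> dist x y \<le> Mc * s \<Longrightarrow>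
      measure M (ball x r) \<le> D * measure M (ball y s)"
    using ball_comparison[of Mc] by metis
  have step: "\<bar>avg M u (B (Suc i)) - avg M u (B i)\<bar> \<le> D * osc (B i) + D * osc (B (Suc i))" for i
  proof -
    obtain d s where ds: "s > 0" "ball d s \<subseteq> B i" "ball d s \<subseteq> B (Suc i)"
        "B i \<subseteq> ball d (Mc * s)" "B (Suc i) \<subseteq> ball d (Mc * s)"
      using link[of i] by blast
    have big: "measure M (ball d (Mc * s)) \<le> D * measure M (ball d s)"
      using D(2)[of s "Mc * s" d d] ds(1) Mc by simp
    have "\<bar>avg M u (ball d s) - avg M u (B j)\<bar> \<le> D * osc (B j)"
      if "ball d s \<subseteq> B j" "B j \<subseteq> ball d (Mc * s)" for j
      unfolding osc_def
    proof (rule avg_subset_diff_le)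
      show "measure M (B j) \<le> D * measure M (ball d s)"
        using measure_mono_ball[OF ball_sets that(2)] big by linarith
    qed (use that ds(1) measure_ball_pos u rho in auto)
    from this[OF ds(2,4)] this[OF ds(3,5)] show ?thesis by linarith
  qed
  \<comment> \<open>As soon as \<open>w i < 1\<close>, the centre and the cut-down radius
    \<open>t i\<close> meet the size restrictions of \<open>osc_le_energy\<close>; the original
    \<open>\<rho> i\<close> might not.\<close>
  have ev: "eventually (\<lambda>i. osc (B i) \<le> K * b i) sequentially"
    using order_tendstoD(2)[OF w_tendsto_0 zero_less_one]
  proof eventually_elim
    case (elim i)
    have "0 \<le> 2 * lam * diameter (B i)" "2 * diameter (B i) \<le> 2 * lam * diameter (B i)"
      using lam diameter_pos[of i] by simp_all
    then have "dist x (c i) < 1" "t i \<le> 1"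
      using elim reach[of i] dist_le[OF center, of i] infdist_pos[of i] diameter_pos[of i]
      unfolding t_def by linarith+
    from K(2)[OF this(1) t_pos this(2)] show ?case by (simp add: ball_t b_def)
  qed
  then have "eventually (\<lambda>i. osc (B (Suc i)) \<le> K * b (Suc i)) sequentially"
    by (subst eventually_sequentially_Suc)
  with ev have "eventually (\<lambda>i. norm (avg M u (B (Suc i)) - avg M u (B i)) \<le> D * (K * b i) + D * (K * b (Suc i))) sequentially"
  proof eventually_elim
    case (elim i)
    have "D * osc (B i) + D * osc (B (Suc i)) \<le> D * (K * b i) + D * (K * b (Suc i))"
      using elim D(1) by (intro add_mono mult_left_mono) auto
    then show ?case using step[of i] by simp
  qed
  moreover have "summable (\<lambda>i. D * (K * b i) + D * (K * b (Suc i)))"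
    using b by (intro summable_add summable_mult) (simp_all add: summable_Suc_iff)
  ultimately show "summable (\<lambda>i. avg M u (B (Suc i)) - avg M u (B i))"
    by (rule summable_comparison_test_ev)
qed

lemma convergent_avg_ball:
  assumes x: "x \<notin> exceptional \<gamma>" and "\<gamma> > 0"
  shows "\<exists>v. ((\<lambda>r. avg M u (ball x r)) \<longlongrightarrow> v) (at_right 0)"
proof -
  obtain v where v: "(\<lambda>i. avg M u (B i)) \<longlonglongrightarrow> v"
    using convergent_avg_chain[OF assms] by (auto simp: convergent_def)
  \<comment> \<open>Product of two comparisons below: \<open>r\<close> with the diameter of the
    preceding ball, and that diameter with the link radius \<open>s\<close>.\<close>
  define K where "K = 2 * Mc * (1 + Mc)"
  obtain D where D: "D \<ge> 1" "\<And>x y r s. s > 0 \<Longrightarrow> r \<le> K * s \<Longrightarrow> dist x y \<le> K * s \<Longrightarrow>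
      measure M (ball x r) \<le> D * measure M (ball y s)"
    using ball_comparison[of K] by metis
  \<comment> \<open>Such an index exists because \<open>w\<close> tends to 0. Minimality makes the
    preceding ball stick out of \<open>ball x r\<close>, so it cannot be small relative to
    \<open>r\<close>.\<close>
  define j where "j r = (LEAST i. B i \<subseteq> ball x r)" for r
  have j: "B (j r) \<subseteq> ball x r" if "r > 0" for r
  proof -
    obtain i where "w i < r"
      using order_tendstoD(2)[OF w_tendsto_0 \<open>r > 0\<close>] by (auto simp: eventually_sequentially)
    have "dist x y < r" if "y \<in> B i" for y
    proof -
      have "0 \<le> 2 * lam * diameter (B i)" using lam diameter_pos[of i] by simp
      then show ?thesis using dist_le[OF that] reach[of i] \<open>w i < r\<close> by linarith
    qed
    then have "B i \<subseteq> ball x r" by auto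
    then show ?thesis unfolding j_def by (rule LeastI)
  qed
  have j_ge: "n \<le> j r" if r: "r > 0" and n: "\<And>i. i < n \<Longrightarrow> r < infdist x (B i)" for r n
  proof (rule ccontr)
    assume "\<not> n \<le> j r"
    then have "r < infdist x (B (j r))" using n by simp
    also have "\<dots> \<le> dist x (c (j r))" by (rule Elementary_Metric_Spaces.infdist_le[OF center])
    finally have "c (j r) \<notin> ball x r" by simp
    then show False using j[OF r] center[of "j r"] by blast
  qed
  have "filterlim j sequentially (at_right 0)"
    unfolding filterlim_at_top
  proof
    fix n
    have "eventually (\<lambda>r. \<forall>i\<in>{..<n}. r < infdist x (B i)) (at_right (0::real))"
      by (intro eventually_ball_finite ballI order_tendstoD(2)[OF tendsto_ident_at] infdist_pos) simp
    then show "eventually (\<lambda>r. n \<le> j r) (at_right 0)"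
      using eventually_at_right_less[of "0::real"]
    proof eventually_elim
      case (elim r)
      then show ?case by (intro j_ge) auto
    qed
  qed
  then have lim1: "((\<lambda>r. avg M u (B (j r))) \<longlongrightarrow> v) (at_right 0)"
    by (rule filterlim_compose[OF v])
  have close: "\<bar>avg M u (B (j r)) - avg M u (ball x r)\<bar> \<le> D * osc (ball x r)"
    if r: "0 < r" "r < infdist x (B 0)" for r
  proof -
    \<comment> \<open>The bound on \<open>r\<close> excludes \<open>B 0\<close>, so a preceding ball
      exists.\<close>
    have "1 \<le> j r" using r by (intro j_ge) auto
    then obtain i where i: "j r = Suc i" by (cases "j r") auto
    then have "\<not> B i \<subseteq> ball x r" unfolding j_def by (intro not_less_Least) (simp add: j_def[symmetric])
    then obtain y where y: "y \<in> B i" "y \<notin> ball x r" by blast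
    then have "r \<le> dist x y" by simp
    have "r \<le> (1 + Mc) * diameter (B i)"
      using \<open>r \<le> dist x y\<close> dist_le[OF y(1)] infdist_le[of i] by (simp add: algebra_simps)
    obtain d s where ds: "s > 0" "ball d s \<subseteq> B (Suc i)" "B i \<subseteq> ball d (Mc * s)"
      using link[of i] by blast
    have "diameter (B i) \<le> diameter (ball d (Mc * s))"
      using ds(3) by (intro diameter_subset) auto
    also have "\<dots> \<le> 2 * (Mc * s)" using ds(1) Mc by (intro diameter_metric_ball_le) auto
    finally have "(1 + Mc) * diameter (B i) \<le> (1 + Mc) * (2 * (Mc * s))"
      using Mc by (intro mult_left_mono) auto
    then have rs: "r \<le> K * s"
      using \<open>r \<le> (1 + Mc) * diameter (B i)\<close> by (simp add: K_def algebra_simps)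
    have "d \<in> ball x r" using ds(1,2) j[OF r(1)] i by (auto simp: subset_iff)
    then have "measure M (ball x r) \<le> D * measure M (ball d s)"
      using D(2)[OF ds(1) rs, of x d] rs by simp
    also have "\<dots> \<le> D * measure M (B (j r))"
      using ds(2) D(1) i by (intro mult_left_mono measure_mono_ball) auto
    finally show ?thesis
      unfolding osc_def using j[OF r(1)] r(1) rho measure_ball_pos u
      by (intro avg_subset_diff_le) auto
  qed
  have ev: "eventually (\<lambda>r. norm (avg M u (B (j r)) - avg M u (ball x r)) \<le> D * osc (ball x r)) (at_right 0)"
    using order_tendstoD(2)[OF tendsto_ident_at infdist_pos[of 0]] eventually_at_right_less[of "0::real"]
    by eventually_elim (simp add: close)
  have "((\<lambda>r. D * osc (ball x r)) \<longlongrightarrow> 0) (at_right 0)"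
    using osc_tendsto_0[OF assms] by (rule tendsto_mult_right_zero)
  then have "((\<lambda>r. avg M u (B (j r)) - avg M u (ball x r)) \<longlongrightarrow> 0) (at_right 0)"
    by (rule Lim_null_comparison[OF ev])
  then have "((\<lambda>r. avg M u (B (j r)) - (avg M u (B (j r)) - avg M u (ball x r))) \<longlongrightarrow> v - 0) (at_right 0)"
    by (intro tendsto_diff lim1)
  then show ?thesis by auto
qed

end


section \<open>Limits at all nonexceptional points, and the theorem\<close>

text \<open>At an isolated point small balls reduce to \<open>{x}\<close> and the averages are
  eventually constant; at every other point a chain with dilation \<open>lam\<close> is
  available.\<close>

lemma (in poincare_space) convergent_avg_ball:
  assumes chain: "chain_condition TYPE('a)" and x: "x \<notin> exceptional \<gamma>" and "\<gamma> > 0"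
  shows "\<exists>v. ((\<lambda>r. avg M u (ball x r)) \<longlongrightarrow> v) (at_right 0)"
proof (cases "\<exists>r>0. ball x r = {x}")
  case True
  then obtain r where r: "r > 0" "ball x r = {x}" by blast
  have "avg M u (ball x s) = avg M u {x}" if "0 < s" "s < r" for s
  proof -
    have "ball x s \<subseteq> ball x r" using that by (intro subset_ball) simp
    then have "ball x s = {x}" using r(2) that(1) by auto
    then show ?thesis by simp
  qed
  then have "eventually (\<lambda>s. avg M u (ball x s) = avg M u {x}) (at_right 0)"
    by (rule eventually_at_rightI[of 0 r]) (use r in auto)
  then show ?thesis by (intro exI tendsto_eventually)
next
  case False
  then have nonisolated: "ball x r \<noteq> {x}" if "r > 0" for r using that by blast
  obtain R where R: "0 < R" "bounded (UNIV::'a set) \<longrightarrow> R < diameter (UNIV::'a set) / 8"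
  proof (cases "bounded (UNIV::'a set)")
    case True
    obtain y where "y \<noteq> x" using nonisolated[of 1] by auto
    then have "0 < diameter (UNIV::'a set)"
      using diameter_bounded_bound[OF True UNIV_I UNIV_I, of x y] by (simp add: less_le_trans[of 0 "dist x y"])
    then show ?thesis by (intro that[of "diameter (UNIV::'a set) / 16"]) auto
  next
    case False
    then show ?thesis using that[of 1] by simp
  qed
  obtain Mc m c \<rho> where Mc: "Mc \<ge> 1" and m: "0 < m" and ch: "\<forall>i. \<rho> i > 0"
    "\<forall>i. diameter (ball (c i) (\<rho> i)) / Mc \<le> infdist x (ball (c i) (\<rho> i)) \<and>
      infdist x (ball (c i) (\<rho> i)) \<le> Mc * diameter (ball (c i) (\<rho> i))"
    "\<forall>i. infdist x (ball (c i) (\<rho> i)) \<le> Mc * R * 2 powr (- m * real i)"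
    "\<forall>i. \<exists>d s. s > 0 \<and> ball d s \<subseteq> ball (c i) (\<rho> i) \<inter> ball (c (Suc i)) (\<rho> (Suc i)) \<and>
      ball (c i) (\<rho> i) \<union> ball (c (Suc i)) (\<rho> (Suc i)) \<subseteq> ball d (Mc * s)"
    "\<forall>y. finite {i. y \<in> ball (c i) (lam * \<rho> i)} \<and>
      real (card {i. y \<in> ball (c i) (lam * \<rho> i)}) \<le> Mc"
    using chain[unfolded chain_condition_def, THEN spec, THEN mp, OF lam]
    by (elim exE conjE) (drule spec[of _ x], drule spec[of _ R], drule mp[OF _ conjI[OF R]],
      elim exE conjE, rule that; assumption)
  interpret poincare_chain M Q C lam u f x c \<rho> Mc R m
    by unfold_locales (use Mc m R(1) nonisolated ch in blast)+
  show ?thesis by (rule convergent_avg_ball[OF x \<open>\<gamma> > 0\<close>])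
qed

theorem theoremB:
  fixes M :: "'a::metric_space measure" and Q \<epsilon> :: real and u g :: "'a \<Rightarrow> real"
  assumes "Q > 1" and "\<epsilon> > 0"
    and "borel_regular_measure M"
    and "Q_doubling M Q"
    and "chain_condition TYPE('a)"
    and "\<forall>x r. r > 0 \<longrightarrow> set_integrable M (ball x r) u"
    and "g \<in> borel_measurable M" and "\<forall>x. g x \<ge> 0" and "integrable M (\<lambda>x. g x powr Q)"
    and "\<exists>C>0. \<exists>lam\<ge>1. \<forall>x r. r > 0 \<longrightarrow>
           avg M (\<lambda>y. \<bar>u y - avg M u (ball x r)\<bar>) (ball x r)
             \<le> C * diameter (ball x r) * (avg M (\<lambda>y. g y powr Q) (ball x (lam * r))) powr (1 / Q)"
  shows "\<exists>E v. gen_hausdorff (log_gauge Q \<epsilon>) E = 0 \<and> (AE y in M. v y = u y) \<and>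
           (\<forall>x\<in>UNIV - E. ((\<lambda>r. avg M u (ball x r)) \<longlongrightarrow> v x) (at_right 0))"
proof -
  obtain C lam where C: "C > 0" "lam \<ge> 1" "\<And>x r. r > 0 \<Longrightarrow>
      avg M (\<lambda>y. \<bar>u y - avg M u (ball x r)\<bar>) (ball x r)
        \<le> C * diameter (ball x r) * (avg M (\<lambda>y. g y powr Q) (ball x (lam * r))) powr (1 / Q)"
    using assms(10) by blast
  interpret poincare_space M Q C lam u "\<lambda>y. g y powr Q"
    using assms C by unfold_locales (auto simp: borel_regular_measure_def Q_doubling_def)
  \<comment> \<open>Half of \<open>\<epsilon>\<close> pays for summability along chains, the other
    half for the geometric decay of the gauge sums.\<close>
  define E where "E = exceptional (\<epsilon> / 2)"
  have "\<epsilon> / 2 > 0" using \<open>\<epsilon> > 0\<close> by simp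
  have "\<exists>v. ((\<lambda>r. avg M u (ball x r)) \<longlongrightarrow> v) (at_right 0)" if "x \<notin> E" for x
    using convergent_avg_ball[OF assms(5)] that \<open>\<epsilon> / 2 > 0\<close> by (auto simp: E_def)
  then obtain l where l: "\<And>x. x \<notin> E \<Longrightarrow> ((\<lambda>r. avg M u (ball x r)) \<longlongrightarrow> l x) (at_right 0)"
    by metis
  \<comment> \<open>Keeping \<open>u\<close> on \<open>E\<close> gives the almost everywhere
    equality without the measure of \<open>E\<close>.\<close>
  define v where "v x = (if x \<in> E then u x else l x)" for x
  have "gen_hausdorff (log_gauge Q \<epsilon>) E = 0"
    using gen_hausdorff_limsup_set_eq_0[OF ball_sets space_M f f_nonneg \<open>Q > 1\<close> \<open>\<epsilon> > 0\<close>]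
    by (simp add: E_def exceptional_def energy_def)
  moreover have "AE y in M. v y = u y"
    using AE_limit_eq
  proof eventually_elim
    case (elim y)
    show ?case
    proof (cases "y \<in> E")
      case False
      then have "((\<lambda>r. osc (ball y r)) \<longlongrightarrow> 0) (at_right 0)"
        unfolding E_def using osc_tendsto_0 \<open>\<epsilon> / 2 > 0\<close> by blast
      with elim l[OF False] False show ?thesis by (simp add: v_def)
    qed (simp add: v_def)
  qed
  moreover have "((\<lambda>r. avg M u (ball x r)) \<longlongrightarrow> v x) (at_right 0)" if "x \<in> UNIV - E" for x
    using l[of x] that by (simp add: v_def)
  ultimately show ?thesis by blast
qed

end
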